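(* Let $\lambda$ be a regular cardinal. Then for every cardinal $\mu$ with $\mu^+<\lambda$ there is a surjective homomorphism $\Phi_\mu:\langle\mathcal G_\lambda,\le_w\rangle\to\langle[\mu^{\aleph_0}]^{\le\lambda},\subseteq\rangle$.
   Context: A ray is a one-way infinite path; two rays are tail-equivalent iff they share a common tail. $\mathcal G$ is the class of all graphs $G$ such that for every vertex $v$, the induced subgraph spanned by the neighbourhood $G[v]$ has at most one ray up to tail-equivalence; $\mathcal G_\lambda$ is the set of isomorphism types of members of $\mathcal G$ with exactly $\lambda$ vertices. $G_1\le_w G_2$ means $G_1$ is isomorphic to a (not necessarily induced) subgraph of $G_2$. For a cardinal $\kappa$ (viewed as a set), $[\kappa]^{\le\lambda}$ is the set of subsets of $\kappa$ of cardinality at most $\lambda$, ordered by inclusion. A homomorphism is an order-preserving map. *)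

theory Defs
  imports Main
begin

unbundle cardinal_syntax

text \<open>Graphs are simple, undirected and of arbitrary size: a vertex set together with a set of
  two-element sets of vertices.\<close>

type_synonym 'v graph = "'v set \<times> 'v set set"

abbreviation verts :: "'v graph \<Rightarrow> 'v set" where "verts \<equiv> fst"
abbreviation edges :: "'v graph \<Rightarrow> 'v set set" where "edges \<equiv> snd"

definition is_graph :: "'v graph \<Rightarrow> bool" where
  "is_graph G \<longleftrightarrow> edges G \<subseteq> {{u, v} |u v. u \<in> verts G \<and> v \<in> verts G \<and> u \<noteq> v}"

definition neighbours :: "'v graph \<Rightarrow> 'v \<Rightarrow> 'v set" where
  "neighbours G v = {u \<in> verts G. {v, u} \<in> edges G}"

definition induced :: "'v graph \<Rightarrow> 'v set \<Rightarrow> 'v graph" where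
  "induced G W = (verts G \<inter> W, {e \<in> edges G. e \<subseteq> W})"

definition is_subgraph :: "'v graph \<Rightarrow> 'v graph \<Rightarrow> bool" where
  "is_subgraph H G \<longleftrightarrow> is_graph H \<and> verts H \<subseteq> verts G \<and> edges H \<subseteq> edges G"

definition graph_iso :: "'v graph \<Rightarrow> 'w graph \<Rightarrow> bool" where
  "graph_iso G H \<longleftrightarrow> (\<exists>h. bij_betw h (verts G) (verts H) \<and> (`) h ` edges G = edges H)"

definition weakly_embeds :: "'v graph \<Rightarrow> 'w graph \<Rightarrow> bool" where
  "weakly_embeds G\<^sub>1 G\<^sub>2 \<longleftrightarrow> (\<exists>H. is_subgraph H G\<^sub>2 \<and> graph_iso G\<^sub>1 H)"

text \<open>A ray is determined by the enumeration of its vertices from its initial vertex.\<close>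

definition is_ray :: "'v graph \<Rightarrow> (nat \<Rightarrow> 'v) \<Rightarrow> bool" where
  "is_ray G r \<longleftrightarrow> inj r \<and> range r \<subseteq> verts G \<and> (\<forall>n. {r n, r (Suc n)} \<in> edges G)"

definition tail_equivalent :: "(nat \<Rightarrow> 'v) \<Rightarrow> (nat \<Rightarrow> 'v) \<Rightarrow> bool" where
  "tail_equivalent r s \<longleftrightarrow> (\<exists>m n. \<forall>k. r (m + k) = s (n + k))"

definition at_most_one_ray :: "'v graph \<Rightarrow> bool" where
  "at_most_one_ray G \<longleftrightarrow> (\<forall>r s. is_ray G r \<longrightarrow> is_ray G s \<longrightarrow> tail_equivalent r s)"

definition class_G :: "'v graph set" where
  "class_G = {G. is_graph G \<and> (\<forall>v \<in> verts G. at_most_one_ray (induced G (neighbours G v)))}"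

text \<open>Cardinals are represented by cardinal orders. Vertices of graphs with \<open>l\<close> many vertices are
  taken from the type underlying \<open>l\<close>; by \<open>class_G_representative\<close> below every isomorphism type
  is represented there.\<close>

definition graphs_of_size :: "'l rel \<Rightarrow> 'l graph set" where
  "graphs_of_size l = {G \<in> class_G. |verts G| =o l}"

definition iso_rel :: "'l rel \<Rightarrow> 'l graph rel" where
  "iso_rel l = {(G, H). G \<in> graphs_of_size l \<and> H \<in> graphs_of_size l \<and> graph_iso G H}"

definition iso_types :: "'l rel \<Rightarrow> 'l graph set set" where
  "iso_types l = graphs_of_size l // iso_rel l"

definition le_w :: "'l graph set \<Rightarrow> 'l graph set \<Rightarrow> bool" where
  "le_w X Y \<longleftrightarrow> (\<exists>G \<in> X. \<exists>H \<in> Y. weakly_embeds G H)"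

definition subsets_upto :: "'k rel \<Rightarrow> 'l rel \<Rightarrow> 'k set set" where
  "subsets_upto k l = {A. A \<subseteq> Field k \<and> |A| \<le>o l}"


lemma graph_iso_refl: "graph_iso G G"
  unfolding graph_iso_def by (rule exI[of _ id]) auto

lemma graph_iso_trans:
  assumes "graph_iso G H" "graph_iso H K" shows "graph_iso G K"
proof -
  obtain f where f: "bij_betw f (verts G) (verts H)" "(`) f ` edges G = edges H"
    using assms(1) unfolding graph_iso_def by blast
  obtain g where g: "bij_betw g (verts H) (verts K)" "(`) g ` edges H = edges K"
    using assms(2) unfolding graph_iso_def by blast
  have "(`) (g \<circ> f) ` edges G = edges K"
    unfolding g(2)[symmetric] f(2)[symmetric] by (simp add: image_image)
  then show ?thesis using bij_betw_trans[OF f(1) g(1)] unfolding graph_iso_def by blast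
qed

lemma is_graph_edge_subset: "is_graph G \<Longrightarrow> e \<in> edges G \<Longrightarrow> e \<subseteq> verts G"
  unfolding is_graph_def by auto

lemma graph_iso_sym:
  assumes "is_graph G" "graph_iso G H" shows "graph_iso H G"
proof -
  obtain f where f: "bij_betw f (verts G) (verts H)" "(`) f ` edges G = edges H"
    using assms(2) unfolding graph_iso_def by blast
  let ?g = "the_inv_into (verts G) f"
  have "?g ` f ` e = e" if "e \<in> edges G" for e
  proof -
    have "?g (f x) = x" if "x \<in> e" for x
      using is_graph_edge_subset[OF assms(1) \<open>e \<in> edges G\<close>] that f(1)
      by (auto simp: bij_betw_def intro: the_inv_into_f_f)
    then show ?thesis by (simp add: image_image)
  qed
  then have "(`) ?g ` edges H = edges G"
    unfolding f(2)[symmetric] by (simp add: image_image)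
  then show ?thesis using bij_betw_the_inv_into[OF f(1)] unfolding graph_iso_def by blast
qed

lemma is_graph_iso:
  assumes "is_graph G" "graph_iso G H" shows "is_graph H"
proof -
  obtain f where f: "bij_betw f (verts G) (verts H)" "(`) f ` edges G = edges H"
    using assms(2) unfolding graph_iso_def by blast
  show ?thesis unfolding is_graph_def
  proof
    fix e assume "e \<in> edges H"
    then obtain d where d: "d \<in> edges G" "e = f ` d"
      using f(2) by blast
    obtain u v where uv: "d = {u, v}" "u \<in> verts G" "v \<in> verts G" "u \<noteq> v"
      using d(1) assms(1) unfolding is_graph_def by blast
    then have "e = {f u, f v}" using d(2) by simp
    moreover have "f u \<in> verts H" "f v \<in> verts H" "f u \<noteq> f v"
      using f(1) uv unfolding bij_betw_def inj_on_def by auto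
    ultimately show "e \<in> {{u, v} |u v. u \<in> verts H \<and> v \<in> verts H \<and> u \<noteq> v}" by blast
  qed
qed

lemma equiv_iso_rel: "equiv (graphs_of_size l) (iso_rel l)"
proof (rule equivI)
  show "sym (iso_rel l)"
    by (auto simp: iso_rel_def sym_def graphs_of_size_def class_G_def intro: graph_iso_sym)
  show "trans (iso_rel l)"
    by (auto simp: iso_rel_def trans_def intro: graph_iso_trans)
qed (auto simp: iso_rel_def refl_on_def graph_iso_refl)

lemma weakly_embeds_cong:
  assumes "is_graph G" "graph_iso G G'" "is_graph H" "graph_iso H H'" "weakly_embeds G H"
  shows "weakly_embeds G' H'"
proof -
  obtain K where K: "is_graph K" "verts K \<subseteq> verts H" "edges K \<subseteq> edges H" "graph_iso G K"
    using assms(5) unfolding weakly_embeds_def is_subgraph_def by blast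
  obtain f where f: "bij_betw f (verts H) (verts H')" "(`) f ` edges H = edges H'"
    using assms(4) unfolding graph_iso_def by blast
  let ?K = "(f ` verts K, (`) f ` edges K)"
  have iso: "graph_iso K ?K"
    unfolding graph_iso_def using K(2) f(1)
    by (auto intro!: exI[of _ f] simp: bij_betw_def intro: inj_on_subset)
  have "is_subgraph ?K H'"
    using is_graph_iso[OF K(1) iso] image_mono[OF K(2), of f] image_mono[OF K(3), of "(`) f"] f
    unfolding is_subgraph_def bij_betw_def by simp
  moreover have "graph_iso G' ?K"
    using graph_iso_trans[OF graph_iso_sym[OF assms(1,2)] graph_iso_trans[OF K(4) iso]] .
  ultimately show ?thesis unfolding weakly_embeds_def by blast
qed

text \<open>The relation on isomorphism types does not depend on representatives.\<close>

lemma le_w_iff: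
  assumes "G \<in> graphs_of_size l" "H \<in> graphs_of_size l"
  shows "le_w (iso_rel l `` {G}) (iso_rel l `` {H}) \<longleftrightarrow> weakly_embeds G H"
proof
  have G: "is_graph G" and H: "is_graph H"
    using assms by (auto simp: graphs_of_size_def class_G_def)
  assume "le_w (iso_rel l `` {G}) (iso_rel l `` {H})"
  then obtain G' H' :: "'a graph"
    where iso: "graph_iso G G'" "graph_iso H H'" and emb: "weakly_embeds G' H'"
    unfolding le_w_def iso_rel_def by blast
  show "weakly_embeds G H"
    using weakly_embeds_cong[OF is_graph_iso[OF G iso(1)] graph_iso_sym[OF G iso(1)]
        is_graph_iso[OF H iso(2)] graph_iso_sym[OF H iso(2)] emb] .
next
  assume "weakly_embeds G H"
  then show "le_w (iso_rel l `` {G}) (iso_rel l `` {H})"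
    using equiv_class_self[OF equiv_iso_rel assms(1)] equiv_class_self[OF equiv_iso_rel assms(2)]
    unfolding le_w_def by blast
qed

lemma class_G_iso:
  assumes "G \<in> class_G" "graph_iso G H" shows "H \<in> class_G"
proof -
  have G: "is_graph G" and H: "is_graph H"
    using assms is_graph_iso[OF _ assms(2)] by (simp_all add: class_G_def)
  obtain g where g: "bij_betw g (verts H) (verts G)" "(`) g ` edges H = edges G"
    using graph_iso_sym[OF G assms(2)] unfolding graph_iso_def by blast
  have edge: "{g u, g v} \<in> edges G" if "{u, v} \<in> edges H" for u v
    using imageI[OF that, of "(`) g"] g(2) by simp
  have ray: "is_ray (induced G (neighbours G (g v))) (g \<circ> r)"
    if "is_ray (induced H (neighbours H v)) r" for v r
  proof -
    have r: "inj r" "range r \<subseteq> verts H" "\<And>n. {v, r n} \<in> edges H"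
        "\<And>n. {r n, r (Suc n)} \<in> edges H"
      using that unfolding is_ray_def induced_def neighbours_def by auto
    have "inj_on g (range r)" using g(1) r(2) by (auto simp: bij_betw_def intro: inj_on_subset)
    then have "inj (g \<circ> r)" using r(1) by (rule comp_inj_on[rotated])
    moreover have "range (g \<circ> r) \<subseteq> verts G"
      using g(1) image_mono[OF r(2), of g] by (simp add: bij_betw_def image_comp)
    ultimately show ?thesis using r(3,4) edge
      unfolding is_ray_def induced_def neighbours_def by auto
  qed
  have "tail_equivalent r s"
    if v: "v \<in> verts H" and rs: "is_ray (induced H (neighbours H v)) r"
      "is_ray (induced H (neighbours H v)) s" for v r s
  proof -
    have "g v \<in> verts G" using v g(1) by (auto simp: bij_betw_def)
    then have "tail_equivalent (g \<circ> r) (g \<circ> s)"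
      using assms(1) ray[OF rs(1)] ray[OF rs(2)] unfolding class_G_def at_most_one_ray_def by blast
    moreover have "range r \<subseteq> verts H" "range s \<subseteq> verts H"
      using rs unfolding is_ray_def induced_def by auto
    then have "g (r i) = g (s j) \<longleftrightarrow> r i = s j" for i j
      using g(1) by (auto simp: bij_betw_def inj_on_eq_iff subset_iff)
    ultimately show ?thesis unfolding tail_equivalent_def by simp
  qed
  then show ?thesis using H unfolding class_G_def at_most_one_ray_def by blast
qed

lemma class_G_representative:
  fixes G :: "'v graph" and l :: "'l rel"
  assumes "G \<in> class_G" "Card_order l" "|verts G| =o l"
  shows "\<exists>H \<in> graphs_of_size l. graph_iso G H"
proof -
  have "|verts G| =o |Field l|"
    using assms(2,3) card_of_Field_ordIso ordIso_symmetric ordIso_transitive by blast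
  then obtain f where f: "bij_betw f (verts G) (Field l)" using card_of_ordIso by blast
  let ?H = "(Field l, (`) f ` edges G)"
  have iso: "graph_iso G ?H" unfolding graph_iso_def using f by auto
  moreover have "?H \<in> graphs_of_size l"
    using class_G_iso[OF assms(1) iso] card_of_Field_ordIso[OF assms(2)]
    by (simp add: graphs_of_size_def)
  ultimately show ?thesis by blast
qed

end

theory Submission
  imports Defs
begin

text \<open>
  Embeddings are injective and a neighbourhood contains only one ray up to tails, so a ray in the
  neighbourhood of a vertex is carried to the essentially unique ray in the neighbourhood of its
  image.

  If \<open>\<mu>\<close> is finite, a binary sequence is coded by the coincidence pattern of the rays at two
  vertices. If \<open>\<mu>\<close> is infinite, \<open>\<lambda>\<close> is uncountable. Numbering the vertices by \<open>\<lambda>\<close>, a ray may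
  converge to an ordinal of cofinality \<open>\<omega>\<close>, and for any two numberings the limits agree on a club.
  A vertex with a ray, every second vertex of which again has a ray, thus codes an \<open>\<omega>\<close>-sequence of
  such ordinals. The invariant of a graph consists of the colours which are coded, in every
  numbering, by some vertex. Colours are supplied by Solovay's splitting of the points of cofinality
  \<open>\<omega>\<close> if \<open>\<mu>\<^sup>\<omega> \<le> \<lambda>\<close>, and by a family of \<open>\<lambda>\<close> many sets of size \<open>\<mu>\<close>, one of which is contained in any
  given club, if \<open>\<lambda> < \<mu>\<^sup>\<omega>\<close>.
\<close>

section \<open>Cardinality bounds\<close>

lemma Cinfinite_card_of_iff: "Cinfinite |A| \<longleftrightarrow> infinite A"
  by (simp add: cinfinite_def Field_card_of card_of_card_order_on)

lemma card_of_ordLeqE: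
  assumes "|A| \<le>o |B|"
  obtains f where "inj_on f A" "f ` A \<subseteq> B"
  using assms by (metis card_of_ordLeq)

lemma card_of_nat_bound:
  assumes "Cinfinite r"
  shows "|A :: nat set| \<le>o r"
  by (meson assms card_of_mono1 subset_UNIV card_of_nat natLeq_ordLeq_cinfinite ordLeq_ordIso_trans
      ordLeq_transitive)

lemma card_of_subsingleton_bound:
  assumes "Cinfinite r" "\<And>x y. x \<in> A \<Longrightarrow> y \<in> A \<Longrightarrow> x = y"
  shows "|A| \<le>o r"
proof -
  have "inj_on (\<lambda>_. 0 :: nat) A" using assms(2) by (simp add: inj_on_def)
  then have "|A| \<le>o |UNIV :: nat set|" by (rule card_of_ordLeqI) simp
  also have "|UNIV :: nat set| \<le>o r" using assms(1) by (rule card_of_nat_bound)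
  finally show ?thesis .
qed

lemma Times_Cinfinite_bound: "\<lbrakk>|A| \<le>o r; |B| \<le>o r; Cinfinite r\<rbrakk> \<Longrightarrow> |A \<times> B| \<le>o r"
  by (auto simp: cinfinite_def intro: card_of_Times_ordLeq_infinite_Field)

lemma Plus_Cinfinite_bound: "\<lbrakk>|A| \<le>o r; |B| \<le>o r; Cinfinite r\<rbrakk> \<Longrightarrow> |A <+> B| \<le>o r"
  by (auto simp: cinfinite_def intro: card_of_Plus_ordLeq_infinite_Field)

lemma card_of_image_bound: "|A| \<le>o r \<Longrightarrow> |f ` A| \<le>o r"
  using card_of_image ordLeq_transitive by blast

lemma lists_Cinfinite_bound:
  assumes A: "|A| \<le>o r" and r: "Cinfinite r"
  shows "|lists A| \<le>o r"
proof -
  have "|{xs \<in> lists A. length xs = n}| \<le>o r" for n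
  proof (induction n)
    case 0
    show ?case using r by (rule card_of_subsingleton_bound) auto
  next
    case (Suc n)
    have "{xs \<in> lists A. length xs = Suc n}
        \<subseteq> case_prod (#) ` (A \<times> {xs \<in> lists A. length xs = n})"
      by (auto simp: length_Suc_conv image_iff)
    then have "|{xs \<in> lists A. length xs = Suc n}| \<le>o |A \<times> {xs \<in> lists A. length xs = n}|"
      by (rule surj_imp_ordLeq)
    also have "|A \<times> {xs \<in> lists A. length xs = n}| \<le>o r"
      using A Suc r by (rule Times_Cinfinite_bound)
    finally show ?case .
  qed
  then have "|\<Union>n\<in>(UNIV :: nat set). {xs \<in> lists A. length xs = n}| \<le>o r"
    using r by (intro UNION_Cinfinite_bound card_of_nat_bound) auto
  moreover have "(\<Union>n\<in>(UNIV :: nat set). {xs \<in> lists A. length xs = n}) = lists A" by auto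
  ultimately show ?thesis by simp
qed

lemma card_of_lists_le: "Cinfinite |A| \<Longrightarrow> |lists A| \<le>o |A|"
  by (intro lists_Cinfinite_bound ordLeq_refl card_of_Card_order)

lemma disjoint_injections_ex:
  assumes B: "Cinfinite |B|" and A: "|A| \<le>o |B|"
  shows "\<exists>f g. inj_on f A \<and> f ` A \<subseteq> B \<and> inj_on g B \<and> g ` B \<subseteq> B \<and> f ` A \<inter> g ` B = {}"
proof -
  have "|A <+> B| \<le>o |B|" using A B by (intro Plus_Cinfinite_bound ordLeq_refl card_of_Card_order)
  then obtain e where e: "inj_on e (A <+> B)" "e ` (A <+> B) \<subseteq> B" by (rule card_of_ordLeqE)
  have "inj_on (e \<circ> Inl) A" "inj_on (e \<circ> Inr) B" "(e \<circ> Inl) ` A \<inter> (e \<circ> Inr) ` B = {}"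
    using e(1) by (auto simp: inj_on_def)
  then show ?thesis using e(2) by (intro exI[of _ "e \<circ> Inl"] exI[of _ "e \<circ> Inr"]) auto
qed

lemma maximal_independent_subset:
  assumes "symp R"
  shows "\<exists>K\<subseteq>E. pairwise (\<lambda>x y. \<not> R x y) K \<and> (\<forall>x\<in>E - K. \<exists>y\<in>K. R x y)"
proof -
  let ?I = "{K. K \<subseteq> E \<and> pairwise (\<lambda>x y. \<not> R x y) K}"
  have "\<exists>K\<in>?I. \<forall>X\<in>?I. K \<subseteq> X \<longrightarrow> X = K"
  proof (rule subset_Zorn')
    fix C assume C: "subset.chain ?I C"
    then have "chain\<^sub>\<subseteq> C" unfolding subset.chain_def chain_subset_def by blast
    moreover have "\<And>S. S \<in> C \<Longrightarrow> pairwise (\<lambda>x y. \<not> R x y) S"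
      using C unfolding subset.chain_def by blast
    ultimately have "pairwise (\<lambda>x y. \<not> R x y) (\<Union>C)" by (intro pairwise_chain_Union)
    moreover have "\<Union>C \<subseteq> E" using C unfolding subset.chain_def by blast
    ultimately show "\<Union>C \<in> ?I" by blast
  qed
  then obtain K where K: "K \<in> ?I" and maximal: "\<And>X. X \<in> ?I \<Longrightarrow> K \<subseteq> X \<Longrightarrow> X = K" by meson
  have "\<exists>y\<in>K. R x y" if x: "x \<in> E - K" for x
  proof (rule ccontr)
    assume "\<not> ?thesis"
    then have "insert x K \<in> ?I" using K x assms by (auto simp: pairwise_insert symp_def)
    then show False using maximal[of "insert x K"] x by blast
  qed
  then show ?thesis using K by blast
qed

lemma independent_subset_full_card:
  assumes r: "Cinfinite r" "r <o |E|" and "symp R"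
    and degree: "\<And>y. y \<in> E \<Longrightarrow> |{x \<in> E. R x y}| \<le>o r"
  shows "\<exists>K\<subseteq>E. pairwise (\<lambda>x y. \<not> R x y) K \<and> |E| \<le>o |K|"
proof -
  obtain K where K: "K \<subseteq> E" "pairwise (\<lambda>x y. \<not> R x y) K" and dominating: "\<forall>x\<in>E - K. \<exists>y\<in>K. R x y"
    using maximal_independent_subset[OF assms(3)] by blast
  have bound: "|E| \<le>o s" if s: "Cinfinite s" "|K| \<le>o s" "r \<le>o s" for s :: "'s rel"
  proof -
    have "|{x \<in> E. R x y}| \<le>o s" if "y \<in> K" for y
      using degree K(1) that s(3) by (blast intro: ordLeq_transitive)
    then have "|K \<union> (\<Union>y\<in>K. {x \<in> E. R x y})| \<le>o s"
      using s by (intro Un_Cinfinite_bound UNION_Cinfinite_bound) auto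
    moreover have "E \<subseteq> K \<union> (\<Union>y\<in>K. {x \<in> E. R x y})" using dominating by blast
    ultimately show ?thesis using card_of_mono1 ordLeq_transitive by blast
  qed
  have "\<not> |K| \<le>o r" using bound[OF r(1) _ ordLeq_refl] r not_ordLess_ordLeq by blast
  then have "r \<le>o |K|"
    using r(1) ordLeq_total[of r "|K|"] card_of_Well_order card_order_on_well_order_on by blast
  moreover have "Cinfinite |K|"
    using cinfinite_mono[OF calculation] r(1) card_of_Card_order[of K] by simp
  ultimately have "|E| \<le>o |K|" by (intro bound ordLeq_refl card_of_Card_order)
  then show ?thesis using K by blast
qed

section \<open>Graphs and rays in neighbourhoods\<close>

lemma is_graphI:
  assumes "\<And>e. e \<in> edges G \<Longrightarrow> \<exists>u\<in>verts G. \<exists>v\<in>verts G. u \<noteq> v \<and> e = {u, v}"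
  shows "is_graph G"
  using assms unfolding is_graph_def by blast

definition nbh_ray :: "'v graph \<Rightarrow> 'v \<Rightarrow> (nat \<Rightarrow> 'v) \<Rightarrow> bool" where
  "nbh_ray G v r \<longleftrightarrow> is_ray (induced G (neighbours G v)) r"

definition nbh_rays :: "'v graph \<Rightarrow> (nat \<Rightarrow> 'v) set" where
  "nbh_rays G = {r. \<exists>v. nbh_ray G v r}"

lemma nbh_ray_iff:
  "nbh_ray G v r \<longleftrightarrow>
    inj r \<and> (\<forall>n. r n \<in> verts G \<and> {v, r n} \<in> edges G \<and> {r n, r (Suc n)} \<in> edges G)"
  unfolding nbh_ray_def is_ray_def induced_def neighbours_def by auto

lemma nbh_ray_imp_is_ray: "nbh_ray G v r \<Longrightarrow> is_ray G r"
  by (auto simp: nbh_ray_iff is_ray_def)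

lemma nbh_ray_tail: "nbh_ray G v r \<Longrightarrow> nbh_ray G v (\<lambda>n. r (i + n))"
  by (auto simp: nbh_ray_iff intro!: injI dest: injD)

lemma nbh_ray_hub_in_verts:
  assumes "is_graph G" "nbh_ray G v r"
  shows "v \<in> verts G"
  using is_graph_edge_subset[OF assms(1), of "{v, r 0}"] assms(2) by (simp add: nbh_ray_iff)

lemma class_GI:
  assumes "is_graph G" "\<And>v r s. nbh_ray G v r \<Longrightarrow> nbh_ray G v s \<Longrightarrow> tail_equivalent r s"
  shows "G \<in> class_G"
  using assms unfolding class_G_def at_most_one_ray_def nbh_ray_def by blast

lemma class_G_nbh_rays_tail_equivalent:
  assumes "G \<in> class_G" "nbh_ray G v r" "nbh_ray G v s"
  shows "tail_equivalent r s"
proof -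
  have "is_graph G" using assms(1) by (simp add: class_G_def)
  then have "v \<in> verts G" using assms(2) by (rule nbh_ray_hub_in_verts)
  then show ?thesis using assms unfolding class_G_def at_most_one_ray_def nbh_ray_def by blast
qed

lemma tail_equivalent_refl: "tail_equivalent r r"
  unfolding tail_equivalent_def by blast

lemma tail_equivalent_sym: "tail_equivalent r s \<Longrightarrow> tail_equivalent s r"
  unfolding tail_equivalent_def by metis

lemma tail_equivalent_tails:
  assumes "\<forall>n. r n = p (i + n)" "\<forall>n. s n = p (j + n)"
  shows "tail_equivalent r s"
  unfolding tail_equivalent_def
  by (rule exI[of _ j], rule exI[of _ i]) (simp add: assms add.left_commute)

text \<open>A ray in a neighbourhood is a finite list of vertices followed by a tail of one fixed ray.\<close>

lemma card_of_nbh_rays: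
  assumes G: "G \<in> class_G" and r: "Cinfinite r" "|verts G| \<le>o r"
  shows "|nbh_rays G| \<le>o r"
proof -
  define some_ray where "some_ray v = (SOME q. nbh_ray G v q)" for v
  define join
    where "join = (\<lambda>(v, xs, n) k.
      if k < length xs then xs ! k else some_ray v (n + (k - length xs)))"
  have "nbh_rays G \<subseteq> join ` (verts G \<times> lists (verts G) \<times> (UNIV :: nat set))"
  proof
    fix q assume "q \<in> nbh_rays G"
    then obtain v where q: "nbh_ray G v q" unfolding nbh_rays_def by blast
    then have "nbh_ray G v (some_ray v)" unfolding some_ray_def by (rule someI[of "nbh_ray G v"])
    then obtain i j where tails: "\<And>k. q (i + k) = some_ray v (j + k)"
      using class_G_nbh_rays_tail_equivalent[OF G q] unfolding tail_equivalent_def by blast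
    have "q k = join (v, map q [0..<i], j) k" for k
      using tails[of "k - i"] by (auto simp: join_def)
    then have "q = join (v, map q [0..<i], j)" by (rule ext)
    moreover have "v \<in> verts G" using nbh_ray_hub_in_verts[OF _ q] G by (simp add: class_G_def)
    moreover have "map q [0..<i] \<in> lists (verts G)" using q by (auto simp: nbh_ray_iff)
    ultimately show "q \<in> join ` (verts G \<times> lists (verts G) \<times> UNIV)" by blast
  qed
  then have "|nbh_rays G| \<le>o |verts G \<times> lists (verts G) \<times> (UNIV :: nat set)|"
    by (rule surj_imp_ordLeq)
  also have "|verts G \<times> lists (verts G) \<times> (UNIV :: nat set)| \<le>o r"
    using r by (intro Times_Cinfinite_bound lists_Cinfinite_bound card_of_nat_bound)
  finally show ?thesis .
qed

lemma injective_nat_walk: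
  fixes k :: "nat \<Rightarrow> nat"
  assumes inj: "inj k" and step: "\<And>n. k (Suc n) = Suc (k n) \<or> k n = Suc (k (Suc n))"
  shows "k n = k 0 + n"
proof -
  have up: "k (Suc n) = Suc (k n)" for n
  proof (rule ccontr)
    assume n: "k (Suc n) \<noteq> Suc (k n)"
    have down: "k (n + i) = Suc (k (Suc (n + i)))" for i
    proof (induction i)
      case 0
      then show ?case using step[of n] n by simp
    next
      case (Suc i)
      have "k (Suc (Suc (n + i))) \<noteq> k (n + i)" using inj_eq[OF inj] by simp
      then show ?case using Suc step[of "Suc (n + i)"] by (metis add_Suc_right nat.inject)
    qed
    have "k (n + i) + i = k n" for i by (induction i) (auto simp: down)
    from this[of "Suc (k n)"] show False by simp
  qed
  show ?thesis by (induction n) (auto simp: up)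
qed

lemma is_ray_along_path:
  assumes r: "is_ray G r" "range r \<subseteq> range p"
    and p: "inj p" "\<And>i j. {p i, p j} \<in> edges G \<Longrightarrow> j = Suc i \<or> i = Suc j"
  shows "\<exists>j. \<forall>n. r n = p (j + n)"
proof -
  have "\<forall>n. \<exists>m. r n = p m" using r(2) by blast
  then obtain k where k: "\<And>n. r n = p (k n)" by metis
  have "inj k" using r(1) k unfolding is_ray_def by (metis injD injI)
  moreover have "k (Suc n) = Suc (k n) \<or> k n = Suc (k (Suc n))" for n
    using p(2)[of "k n" "k (Suc n)"] r(1) k by (simp add: is_ray_def)
  ultimately have "k n = k 0 + n" for n by (rule injective_nat_walk)
  then show ?thesis using k by metis
qed

lemma is_ray_avoids_finite_component:
  assumes r: "is_ray G r" "range r \<subseteq> F \<union> B" and F: "finite F"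
    and no_edge: "\<And>u w. u \<in> F \<Longrightarrow> w \<in> B \<Longrightarrow> {u, w} \<notin> edges G"
  shows "range r \<subseteq> B"
proof -
  have "r n \<notin> F" for n
  proof
    assume n: "r n \<in> F"
    have "r (n + i) \<in> F" for i
    proof (induction i)
      case (Suc i)
      have "{r (n + i), r (Suc (n + i))} \<in> edges G" using r(1) unfolding is_ray_def by blast
      then have "r (Suc (n + i)) \<notin> B" using no_edge[OF Suc] by blast
      then show ?case using r(2) by auto
    qed (use n in simp)
    then have "finite (range (\<lambda>i. r (n + i)))" using F by (meson finite_subset image_subsetI)
    moreover have "inj (\<lambda>i. r (n + i))" using r(1) by (intro injI) (simp add: is_ray_def inj_eq)
    ultimately show False using finite_imageD by blast
  qed
  then show ?thesis using r(2) by blast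
qed

lemma no_nbh_ray_if_finite_degree:
  assumes "finite {u. {v, u} \<in> edges G}"
  shows "\<not> nbh_ray G v r"
proof
  assume r: "nbh_ray G v r"
  then have "range r \<subseteq> {u. {v, u} \<in> edges G} \<union> {}" by (auto simp: nbh_ray_iff)
  with nbh_ray_imp_is_ray[OF r] have "range r \<subseteq> {}"
    using assms by (rule is_ray_avoids_finite_component) simp
  then show False by blast
qed

section \<open>Homomorphisms from embedding-monotone invariants\<close>

definition graph_embedding :: "('v \<Rightarrow> 'w) \<Rightarrow> 'v graph \<Rightarrow> 'w graph \<Rightarrow> bool" where
  "graph_embedding f G H \<longleftrightarrow> inj_on f (verts G) \<and> f ` verts G \<subseteq> verts H \<and>
    (\<forall>u v. {u, v} \<in> edges G \<longrightarrow> {f u, f v} \<in> edges H)"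

lemma weakly_embeds_imp_graph_embedding:
  assumes "weakly_embeds G H"
  shows "\<exists>f. graph_embedding f G H"
proof -
  obtain K where K: "verts K \<subseteq> verts H" "edges K \<subseteq> edges H" "graph_iso G K"
    using assms unfolding weakly_embeds_def is_subgraph_def by blast
  obtain f where f: "bij_betw f (verts G) (verts K)" "(`) f ` edges G = edges K"
    using K(3) unfolding graph_iso_def by blast
  have "{f u, f v} \<in> edges H" if "{u, v} \<in> edges G" for u v
    using imageI[OF that, of "(`) f"] f(2) K(2) by auto
  then have "graph_embedding f G H" using f(1) K(1) by (auto simp: graph_embedding_def bij_betw_def)
  then show ?thesis by blast
qed

lemma graph_iso_imp_weakly_embeds:
  assumes "is_graph G" "graph_iso G H"
  shows "weakly_embeds G H" "weakly_embeds H G"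
proof -
  have embeds: "weakly_embeds G H" if "is_graph G" "graph_iso G H"
    for G :: "'x graph" and H :: "'y graph"
    using that is_graph_iso[OF that] unfolding weakly_embeds_def is_subgraph_def by blast
  show "weakly_embeds G H" using assms by (rule embeds)
  show "weakly_embeds H G" using is_graph_iso[OF assms] graph_iso_sym[OF assms] by (rule embeds)
qed

lemma nbh_ray_graph_embedding:
  assumes f: "graph_embedding f G H" and r: "nbh_ray G v r"
  shows "nbh_ray H (f v) (f \<circ> r)"
proof -
  have "inj r" "range r \<subseteq> verts G" using r by (auto simp: nbh_ray_iff)
  then have "inj (f \<circ> r)" using f unfolding graph_embedding_def by (meson comp_inj_on inj_on_subset)
  then show ?thesis using f r by (auto simp: graph_embedding_def nbh_ray_iff)
qed

definition hom_onto_subsets :: "'l rel \<Rightarrow> 'm set \<Rightarrow> bool" where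
  "hom_onto_subsets l M \<longleftrightarrow> (\<exists>\<Phi> :: 'l graph set \<Rightarrow> 'm set. monotone_on (iso_types l) le_w (\<subseteq>) \<Phi> \<and>
    \<Phi> ` iso_types l = {A. A \<subseteq> M \<and> |A| \<le>o l})"

lemma monotone_invariant_iso_class:
  fixes \<Psi> :: "'l graph \<Rightarrow> 'k set"
  assumes mono: "\<And>G H. G \<in> graphs_of_size l \<Longrightarrow> H \<in> graphs_of_size l \<Longrightarrow> weakly_embeds G H \<Longrightarrow> \<Psi> G \<subseteq> \<Psi> H"
    and G: "G \<in> graphs_of_size l"
  shows "\<Union> (\<Psi> ` (iso_rel l `` {G})) = \<Psi> G"
proof -
  have "\<Psi> H = \<Psi> G" if "H \<in> iso_rel l `` {G}" for H
  proof -
    have H: "H \<in> graphs_of_size l" "graph_iso G H" using that by (auto simp: iso_rel_def)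
    have "is_graph G" using G by (simp add: graphs_of_size_def class_G_def)
    then show ?thesis
      using mono[OF G H(1)] mono[OF H(1) G] graph_iso_imp_weakly_embeds[OF _ H(2)] by blast
  qed
  moreover have "G \<in> iso_rel l `` {G}" using equiv_class_self[OF equiv_iso_rel G] .
  ultimately show ?thesis by blast
qed

lemma iso_typesE:
  assumes "X \<in> iso_types l"
  obtains G where "G \<in> graphs_of_size l" "X = iso_rel l `` {G}"
  using assms unfolding iso_types_def quotient_def by blast

theorem hom_onto_subsets_of_invariant:
  fixes l :: "'l rel" and \<Psi> :: "'l graph \<Rightarrow> 'k set"
  assumes l: "Card_order l"
    and mono: "\<And>G H. G \<in> graphs_of_size l \<Longrightarrow> H \<in> graphs_of_size l \<Longrightarrow> weakly_embeds G H \<Longrightarrow> \<Psi> G \<subseteq> \<Psi> H"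
    and bounded: "\<And>G. G \<in> graphs_of_size l \<Longrightarrow> \<Psi> G \<subseteq> K \<and> |\<Psi> G| \<le>o l"
    and onto: "\<And>A. A \<subseteq> K \<Longrightarrow> |A| \<le>o l \<Longrightarrow>
      \<exists>G :: 'v graph. G \<in> class_G \<and> |verts G| =o l \<and> (\<forall>H. graph_iso G H \<longrightarrow> \<Psi> H = A)"
  shows "hom_onto_subsets l K"
proof -
  define \<Phi> where "\<Phi> X = \<Union> (\<Psi> ` X)" for X
  have \<Phi>: "\<Phi> (iso_rel l `` {G}) = \<Psi> G" if "G \<in> graphs_of_size l" for G
    unfolding \<Phi>_def using monotone_invariant_iso_class[of l \<Psi> G] mono that by blast
  have "monotone_on (iso_types l) le_w (\<subseteq>) \<Phi>"
  proof (rule monotone_onI)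
    fix X Y assume X: "X \<in> iso_types l" and Y: "Y \<in> iso_types l" and le: "le_w X Y"
    obtain G where G: "G \<in> graphs_of_size l" "X = iso_rel l `` {G}" using X by (rule iso_typesE)
    obtain H where H: "H \<in> graphs_of_size l" "Y = iso_rel l `` {H}" using Y by (rule iso_typesE)
    have "weakly_embeds G H" using le le_w_iff[OF G(1) H(1)] unfolding G(2) H(2) by blast
    then show "\<Phi> X \<subseteq> \<Phi> Y" using mono[OF G(1) H(1)] \<Phi> G H by simp
  qed
  moreover have "\<Phi> X \<subseteq> K \<and> |\<Phi> X| \<le>o l" if X: "X \<in> iso_types l" for X
    using X by (rule iso_typesE) (simp add: \<Phi> bounded)
  moreover have "A \<in> \<Phi> ` iso_types l" if A: "A \<subseteq> K" "|A| \<le>o l" for A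
  proof -
    obtain G :: "'v graph" where G: "G \<in> class_G" "|verts G| =o l"
      and inv: "\<And>H. graph_iso G H \<Longrightarrow> \<Psi> H = A"
      using onto[OF A] by blast
    obtain H where H: "H \<in> graphs_of_size l" "graph_iso G H"
      using class_G_representative[OF G(1) l G(2)] by blast
    have "\<Phi> (iso_rel l `` {H}) = A" using \<Phi>[OF H(1)] inv[OF H(2)] by simp
    then show ?thesis using quotientI[OF H(1)] unfolding iso_types_def by blast
  qed
  ultimately show ?thesis unfolding hom_onto_subsets_def by (intro exI[of _ \<Phi>]) blast
qed

lemma hom_onto_subsets_antimono:
  assumes hom: "hom_onto_subsets l K" and M: "|M| \<le>o |K|"
  shows "hom_onto_subsets l M"
proof -
  obtain \<Phi> where mono: "monotone_on (iso_types l) le_w (\<subseteq>) \<Phi>"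
    and image: "\<Phi> ` iso_types l = {A. A \<subseteq> K \<and> |A| \<le>o l}"
    using hom unfolding hom_onto_subsets_def by blast
  obtain i where i: "inj_on i M" "i ` M \<subseteq> K" using M by (rule card_of_ordLeqE)
  let ?\<Phi> = "\<lambda>X. {a \<in> M. i a \<in> \<Phi> X}"
  have "monotone_on (iso_types l) le_w (\<subseteq>) ?\<Phi>" using mono unfolding monotone_on_def by blast
  moreover have "|?\<Phi> X| \<le>o l" if "X \<in> iso_types l" for X
  proof -
    have "inj_on i (?\<Phi> X)" using i(1) by (rule inj_on_subset) blast
    then have "|?\<Phi> X| \<le>o |\<Phi> X|" by (rule card_of_ordLeqI) blast
    also have "|\<Phi> X| \<le>o l" using image that by blast
    finally show ?thesis .
  qed
  moreover have "A \<in> ?\<Phi> ` iso_types l" if A: "A \<subseteq> M" "|A| \<le>o l" for A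
  proof -
    have "i ` A \<subseteq> K" using A(1) i(2) by blast
    then have "i ` A \<in> \<Phi> ` iso_types l" unfolding image using card_of_image_bound[OF A(2)] by blast
    then obtain X where "X \<in> iso_types l" "i ` A = \<Phi> X" by blast
    moreover have "{a \<in> M. i a \<in> i ` A} = A" using A(1) inj_on_image_mem_iff[OF i(1)] by blast
    ultimately show ?thesis by auto
  qed
  ultimately show ?thesis unfolding hom_onto_subsets_def by (intro exI[of _ ?\<Phi>]) blast
qed

section \<open>Binary sequences\<close>

text \<open>The sequence \<open>1, 1, 0, x 0, 0, x 1, 0, \<dots>\<close>: two consecutive ones occur only at the start, so it
  is not a proper shift of another such sequence.\<close>

definition marked :: "(nat \<Rightarrow> bool) \<Rightarrow> nat \<Rightarrow> bool" where
  "marked x n \<longleftrightarrow> n < 2 \<or> odd n \<and> x ((n - 3) div 2)"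

lemma marked_initial: "marked x 0" "marked x 1" "\<not> marked x 2"
  by (auto simp: marked_def)

lemma marked_inject:
  assumes "\<And>n. marked x n \<longleftrightarrow> marked y n"
  shows "x = y"
proof
  fix m show "x m = y m" using assms[of "2 * m + 3"] by (simp add: marked_def)
qed

lemma marked_eq_tail:
  assumes "\<And>n. marked z n \<longleftrightarrow> marked x (i + n)"
  shows "z = x"
proof -
  have "marked x i" "marked x (Suc i)" using assms[of 0] assms[of 1] marked_initial[of z] by auto
  then have "i = 0" by (auto simp: marked_def)
  then show ?thesis using assms by (intro marked_inject) simp
qed

datatype 'a twin_vertex = Hub bool "nat \<Rightarrow> bool" | Rim bool "nat \<Rightarrow> bool" nat | Pad 'a

definition rim :: "bool \<Rightarrow> (nat \<Rightarrow> bool) \<Rightarrow> nat \<Rightarrow> 'a twin_vertex" where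
  "rim c x n = Rim (c \<or> marked x n) x n"

text \<open>For each \<open>x\<close> there are two hubs whose neighbourhoods are rays, and the \<open>n\<close>-th vertices of
  these rays coincide exactly when \<open>marked x n\<close>; injectivity makes embeddings respect this pattern.\<close>

definition twin_fans :: "(nat \<Rightarrow> bool) set \<Rightarrow> 'a set \<Rightarrow> 'a twin_vertex graph" where
  "twin_fans A P =
    (case_prod Hub ` (UNIV \<times> A) \<union> (\<lambda>(c, x, n). Rim c x n) ` (UNIV \<times> A \<times> UNIV) \<union> Pad ` P,
     {{Hub c x, rim c x n} |c x n. x \<in> A} \<union> {{rim c x n, rim c x (Suc n)} |c x n. x \<in> A})"

definition coincidence_patterns :: "'v graph \<Rightarrow> (nat \<Rightarrow> bool) set" where
  "coincidence_patterns G =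
    {x. \<exists>v w r s. nbh_ray G v r \<and> nbh_ray G w s \<and> (\<forall>n. r n = s n \<longleftrightarrow> marked x n)}"

lemma coincidence_patterns_mono:
  assumes "weakly_embeds G H"
  shows "coincidence_patterns G \<subseteq> coincidence_patterns H"
proof
  obtain f where f: "graph_embedding f G H"
    using weakly_embeds_imp_graph_embedding[OF assms] by blast
  fix x assume "x \<in> coincidence_patterns G"
  then obtain v w r s where r: "nbh_ray G v r" and s: "nbh_ray G w s"
    and x: "\<And>n. r n = s n \<longleftrightarrow> marked x n"
    unfolding coincidence_patterns_def by blast
  have inj: "inj_on f (verts G)" using f by (simp add: graph_embedding_def)
  have "r n \<in> verts G" "s n \<in> verts G" for n using r s by (auto simp: nbh_ray_iff)
  then have "(f \<circ> r) n = (f \<circ> s) n \<longleftrightarrow> marked x n" for n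
    using x by (simp add: inj_on_eq_iff[OF inj])
  then show "x \<in> coincidence_patterns H"
    using nbh_ray_graph_embedding[OF f r] nbh_ray_graph_embedding[OF f s]
    unfolding coincidence_patterns_def by blast
qed

lemma card_of_coincidence_patterns:
  assumes "G \<in> class_G" "Cinfinite r" "|verts G| \<le>o r"
  shows "|coincidence_patterns G| \<le>o r"
proof -
  let ?X = "\<lambda>(r, s). {x. \<forall>n. r n = s n \<longleftrightarrow> marked x n}"
  have "|?X p| \<le>o r" for p
    using assms(2) by (rule card_of_subsingleton_bound) (auto intro: marked_inject)
  then have "|\<Union>p\<in>nbh_rays G \<times> nbh_rays G. ?X p| \<le>o r"
    using assms by (intro UNION_Cinfinite_bound Times_Cinfinite_bound card_of_nbh_rays) auto
  moreover have "coincidence_patterns G = (\<Union>p\<in>nbh_rays G \<times> nbh_rays G. ?X p)"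
    unfolding coincidence_patterns_def nbh_rays_def by blast
  ultimately show ?thesis by simp
qed

lemma rim_eq_iff: "rim c x m = rim d y n \<longleftrightarrow> x = y \<and> m = n \<and> (c = d \<or> marked x m)"
  by (auto simp: rim_def)

lemma twin_fans_edges:
  "{Hub c x, u} \<in> edges (twin_fans A P) \<longleftrightarrow> x \<in> A \<and> u \<in> range (rim c x)"
  "{Rim c x m, Rim d y n} \<in> edges (twin_fans A P) \<Longrightarrow> n = Suc m \<or> m = Suc n"
  "{Pad a, u} \<notin> edges (twin_fans A P)"
  by (auto simp: twin_fans_def rim_def doubleton_eq_iff image_iff)

lemma twin_fans_finite_degree: "finite {u. {Rim c x n, u} \<in> edges (twin_fans A P)}"
proof -
  let ?F = "{Hub True x, Hub False x} \<union>
    rim True x ` {n - 1, Suc n} \<union> rim False x ` {n - 1, Suc n}"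
  have "{u. {Rim c x n, u} \<in> edges (twin_fans A P)} \<subseteq> ?F"
    by (auto simp: twin_fans_def rim_def doubleton_eq_iff)
  then show ?thesis by (rule finite_subset) simp
qed

lemma twin_fans_nbh_rayD:
  assumes "nbh_ray (twin_fans A P) v r"
  shows "\<exists>c. \<exists>x\<in>A. v = Hub c x \<and> (\<exists>j. \<forall>n. r n = rim c x (j + n))"
proof (cases v)
  case (Hub c x)
  then have x: "x \<in> A" "range r \<subseteq> range (rim c x)"
    using assms by (auto simp: nbh_ray_iff twin_fans_edges)
  have "\<exists>j. \<forall>n. r n = rim c x (j + n)"
  proof (rule is_ray_along_path[OF nbh_ray_imp_is_ray[OF assms] x(2)])
    show "inj (rim c x)" by (simp add: inj_on_def rim_eq_iff)
  qed (auto simp: rim_def dest: twin_fans_edges(2))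
  then show ?thesis using x(1) Hub by blast
next
  case (Rim c x n)
  then show ?thesis using no_nbh_ray_if_finite_degree[OF twin_fans_finite_degree] assms by blast
next
  case (Pad a)
  then show ?thesis using assms by (simp add: nbh_ray_iff twin_fans_edges(3))
qed

lemma twin_fans_nbh_ray:
  assumes "x \<in> A"
  shows "nbh_ray (twin_fans A P) (Hub c x) (rim c x)"
proof -
  have "{rim c x n, rim c x (Suc n)} \<in> edges (twin_fans A P)" for n
    unfolding twin_fans_def snd_conv using assms by blast
  moreover have "rim c x n \<in> verts (twin_fans A P)" for n
    using assms by (auto simp: twin_fans_def rim_def image_iff)
  ultimately show ?thesis
    using assms by (simp add: nbh_ray_iff twin_fans_edges(1) inj_on_def rim_eq_iff)
qed

lemma twin_fans_is_graph: "is_graph (twin_fans A P)"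
proof (rule is_graphI)
  let ?G = "twin_fans A P"
  fix e assume "e \<in> edges ?G"
  then consider (spoke) c x n where "x \<in> A" "e = {Hub c x, rim c x n}"
    | (rim) c x n where "x \<in> A" "e = {rim c x n, rim c x (Suc n)}"
    by (auto simp: twin_fans_def)
  then obtain u v where "e = {u, v}" "u \<in> verts ?G" "v \<in> verts ?G" "u \<noteq> v"
    by cases (auto simp: twin_fans_def rim_def image_iff)
  then show "\<exists>u\<in>verts ?G. \<exists>v\<in>verts ?G. u \<noteq> v \<and> e = {u, v}" by blast
qed

lemma twin_fans_in_class_G: "twin_fans A P \<in> class_G"
proof (rule class_GI[OF twin_fans_is_graph])
  fix v r s assume "nbh_ray (twin_fans A P) v r" "nbh_ray (twin_fans A P) v s"
  from this[THEN twin_fans_nbh_rayD] show "tail_equivalent r s"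
    by (auto intro: tail_equivalent_tails)
qed

lemma coincidence_patterns_twin_fans: "coincidence_patterns (twin_fans A P) = A"
proof (intro equalityI subsetI)
  fix z assume "z \<in> coincidence_patterns (twin_fans A P)"
  then obtain v w r s where r: "nbh_ray (twin_fans A P) v r" and s: "nbh_ray (twin_fans A P) w s"
    and z: "\<And>n. r n = s n \<longleftrightarrow> marked z n"
    unfolding coincidence_patterns_def by blast
  obtain c x i where x: "x \<in> A" "\<And>n. r n = rim c x (i + n)" using twin_fans_nbh_rayD[OF r] by blast
  obtain d y j where y: "\<And>n. s n = rim d y (j + n)" using twin_fans_nbh_rayD[OF s] by blast
  have eq: "marked z n \<longleftrightarrow> x = y \<and> i = j \<and> (c = d \<or> marked x (i + n))" for n
    using z[of n] x(2) y by (auto simp: rim_eq_iff)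
  then have "marked z n \<longleftrightarrow> marked x (i + n)" for n
    using eq[of 0] eq[of 2] marked_initial[of z] by blast
  then show "z \<in> A" using marked_eq_tail[of z x i] x(1) by blast
next
  fix x assume x: "x \<in> A"
  have "rim True x n = rim False x n \<longleftrightarrow> marked x n" for n by (simp add: rim_eq_iff)
  then show "x \<in> coincidence_patterns (twin_fans A P)"
    unfolding coincidence_patterns_def using twin_fans_nbh_ray[OF x] by blast
qed

lemma card_of_twin_fans:
  assumes l: "Cinfinite l" and A: "|A| \<le>o l"
  shows "|verts (twin_fans A (Field l))| =o l"
proof -
  have bool: "|UNIV :: bool set| \<le>o l" using ctwo_ordLeq_Cinfinite[OF l] by (simp add: ctwo_def)
  have F: "|Field l| =o l" using l by (simp add: card_of_Field_ordIso)
  have "|verts (twin_fans A (Field l))| \<le>o l"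
    unfolding twin_fans_def fst_conv
    by (intro Un_Cinfinite_bound card_of_image_bound Times_Cinfinite_bound card_of_nat_bound
        l A bool ordIso_imp_ordLeq[OF F])
  moreover have "|Field l| \<le>o |verts (twin_fans A (Field l))|"
    by (rule card_of_ordLeqI[of Pad]) (auto simp: twin_fans_def inj_on_def)
  ultimately show ?thesis
    using F by (meson ordIso_iff_ordLeq ordIso_symmetric ordIso_ordLeq_trans)
qed

theorem hom_onto_subsets_if_le_continuum:
  fixes l :: "'l rel"
  assumes l: "Cinfinite l" and M: "|M| \<le>o |UNIV :: (nat \<Rightarrow> bool) set|"
  shows "hom_onto_subsets l M"
proof (rule hom_onto_subsets_antimono[OF hom_onto_subsets_of_invariant M])
  show "Card_order l" using l by blast
  fix G assume "G \<in> graphs_of_size l"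
  then have "|coincidence_patterns G| \<le>o l"
    using l
    by (intro card_of_coincidence_patterns) (auto simp: graphs_of_size_def ordIso_imp_ordLeq)
  then show "coincidence_patterns G \<subseteq> UNIV \<and> |coincidence_patterns G| \<le>o l" by simp
next
  show "\<exists>G :: 'l twin_vertex graph. G \<in> class_G \<and> |verts G| =o l \<and>
      (\<forall>H :: 'l graph. graph_iso G H \<longrightarrow> coincidence_patterns H = A)" if A: "|A| \<le>o l" for A
  proof (intro exI conjI allI impI)
    show "twin_fans A (Field l) \<in> class_G" by (rule twin_fans_in_class_G)
    show "|verts (twin_fans A (Field l))| =o l" using l A by (rule card_of_twin_fans)
    fix H :: "'l graph" assume "graph_iso (twin_fans A (Field l)) H"
    note embeds = graph_iso_imp_weakly_embeds[OF twin_fans_is_graph this]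
    show "coincidence_patterns H = A"
      using embeds[THEN coincidence_patterns_mono] by (simp add: coincidence_patterns_twin_fans)
  qed
qed (rule coincidence_patterns_mono)

section \<open>Limits and suprema in well-orders\<close>

definition order_lim :: "(nat \<Rightarrow> 'a::linorder) \<Rightarrow> 'a \<Rightarrow> bool" where
  "order_lim z y \<longleftrightarrow> (\<forall>\<^sub>F n in sequentially. z n < y) \<and> (\<forall>x<y. \<forall>\<^sub>F n in sequentially. x < z n)"

lemma order_lim_unique:
  assumes "order_lim z y" "order_lim z y'"
  shows "y = y'"
proof -
  have False if lim: "order_lim z a" "order_lim z b" "a < b" for a b
  proof -
    have "\<forall>\<^sub>F n in sequentially. z n < a \<and> a < z n"
      using lim unfolding order_lim_def by (intro eventually_conj) blast+
    from eventually_happens'[OF sequentially_bot this] show False by fastforce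
  qed
  then show ?thesis using assms by (metis linorder_less_linear)
qed

lemma order_lim_tail_iff: "order_lim (\<lambda>n. z (i + n)) y \<longleftrightarrow> order_lim z y"
proof -
  have "(\<forall>\<^sub>F n in sequentially. P (i + n)) \<longleftrightarrow> (\<forall>\<^sub>F n in sequentially. P n)" for P
    using eventually_sequentially_seg[of P i] by (simp add: add.commute)
  from this[of "\<lambda>n. z n < y"] this[of "\<lambda>n. _ < z n"] show ?thesis unfolding order_lim_def by simp
qed

definition strict_sup :: "'a::wellorder set \<Rightarrow> 'a" where
  "strict_sup X = (LEAST u. \<forall>x\<in>X. x < u)"

lemma less_strict_sup: "\<forall>x\<in>X. x < b \<Longrightarrow> x \<in> X \<Longrightarrow> x < strict_sup X"
  unfolding strict_sup_def using LeastI[of "\<lambda>u. \<forall>x\<in>X. x < u" b] by blast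

lemma strict_sup_le: "\<forall>x\<in>X. x < b \<Longrightarrow> strict_sup X \<le> b"
  unfolding strict_sup_def by (rule Least_le)

lemma less_strict_supD: "z < strict_sup X \<Longrightarrow> \<exists>x\<in>X. z \<le> x"
  using not_less_Least[of z "\<lambda>u. \<forall>x\<in>X. x < u"] by (auto simp: strict_sup_def not_less)

lemma strict_sup_eq_if_cofinal:
  assumes "\<forall>x\<in>X. \<exists>y\<in>Y. x \<le> y" "\<forall>y\<in>Y. \<exists>x\<in>X. y \<le> x"
  shows "strict_sup X = strict_sup Y"
proof -
  have "(\<forall>x\<in>X. x < u) \<longleftrightarrow> (\<forall>y\<in>Y. y < u)" for u using assms by (meson le_less_trans)
  then show ?thesis unfolding strict_sup_def by simp
qed

lemma order_lim_strict_sup: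
  fixes z :: "nat \<Rightarrow> 'a::wellorder"
  assumes "strict_mono z" "\<forall>n. z n < b"
  shows "order_lim z (strict_sup (range z))"
  unfolding order_lim_def
proof (intro conjI allI impI)
  show "\<forall>\<^sub>F n in sequentially. z n < strict_sup (range z)"
    using assms(2) by (simp add: less_strict_sup)
next
  fix x assume "x < strict_sup (range z)"
  then obtain n where "x \<le> z n" using less_strict_supD by blast
  then have "x < z k" if "k \<ge> Suc n" for k
    using that assms(1) by (meson Suc_le_lessD le_less_trans strict_monoD)
  then show "\<forall>\<^sub>F n in sequentially. x < z n" by (rule eventually_sequentiallyI)
qed

lemma omega_chain:
  assumes "a \<in> A" "\<And>u. u \<in> A \<Longrightarrow> \<exists>v\<in>A. R u v"
  shows "\<exists>z. z 0 = a \<and> (\<forall>n :: nat. z n \<in> A \<and> R (z n) (z (Suc n)))"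
proof -
  have "\<exists>z. \<forall>n. (z n \<in> A \<and> (n = 0 \<longrightarrow> z n = a)) \<and> R (z n) (z (Suc n))"
    by (rule dependent_nat_choice) (use assms in auto)
  then show ?thesis by blast
qed

lemma transfinite_chain:
  fixes \<tau> :: "'a::wellorder" and A :: "'b set"
  assumes extend: "\<And>i F. i < \<tau> \<Longrightarrow> F ` {..<i} \<subseteq> A \<Longrightarrow> \<exists>r\<in>A. \<forall>k<i. R (F k) r"
  shows "\<exists>F. \<forall>i<\<tau>. F i \<in> A \<and> (\<forall>k<i. R (F k) (F i))"
proof -
  let ?Q = "\<lambda>F i r. i < \<tau> \<longrightarrow> r \<in> A \<and> (\<forall>k<i. R (F k) r)"
  have "\<exists>F. \<forall>i. ?Q F i (F i)"
  proof (rule dependent_wf_choice[OF wf, where P = ?Q])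
    fix F G :: "'a \<Rightarrow> 'b" and i r assume "\<And>k. (k, i) \<in> {(x, y). x < y} \<Longrightarrow> F k = G k"
    then show "?Q F i r = ?Q G i r" by simp
  next
    fix i and F :: "'a \<Rightarrow> 'b" assume "\<And>k. (k, i) \<in> {(x, y). x < y} \<Longrightarrow> ?Q F k (F k)"
    then have "i < \<tau> \<Longrightarrow> F ` {..<i} \<subseteq> A" by auto
    then show "\<exists>r. ?Q F i r" using extend[of i F] by blast
  qed
  then show ?thesis by blast
qed

section \<open>Regular uncountable cardinals\<close>

locale regular_uncountable =
  fixes L :: "'a::wellorder set"
  assumes downward_closed: "y \<in> L \<Longrightarrow> x < y \<Longrightarrow> x \<in> L"
    and segment_small: "x \<in> L \<Longrightarrow> |{..<x}| <o |L|"
    and bounded_if_small: "X \<subseteq> L \<Longrightarrow> |X| <o |L| \<Longrightarrow> \<exists>b\<in>L. \<forall>x\<in>X. x < b"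
    and uncountable: "natLeq <o |L|"
begin

lemma Cinfinite_L: "Cinfinite |L|"
  using cinfinite_mono[OF ordLess_imp_ordLeq[OF uncountable] natLeq_cinfinite]
    card_of_Card_order[of L] by simp

lemma downward_closed_le: "y \<in> L \<Longrightarrow> x \<le> y \<Longrightarrow> x \<in> L"
  using downward_closed by (cases "x = y") auto

lemma nat_set_small: "|A :: nat set| <o |L|"
  using uncountable card_of_nat_bound[OF natLeq_Cinfinite] ordLeq_ordLess_trans by blast

lemma finite_small: "finite A \<Longrightarrow> |A| <o |L|"
  using uncountable finite_iff_ordLess_natLeq ordLess_transitive by blast

lemma image_bounded:
  assumes "|I| <o |L|" "\<And>i. i \<in> I \<Longrightarrow> g i \<in> L"
  shows "\<exists>b\<in>L. \<forall>i\<in>I. g i < b"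
proof -
  have "|g ` I| <o |L|" using card_of_image assms(1) by (rule ordLeq_ordLess_trans)
  moreover have "g ` I \<subseteq> L" using assms(2) by blast
  ultimately show ?thesis using bounded_if_small[of "g ` I"] by simp
qed

lemma sequence_bounded: "(\<And>n :: nat. z n \<in> L) \<Longrightarrow> \<exists>b\<in>L. \<forall>n. z n < b"
  using image_bounded[OF nat_set_small, of UNIV z] by blast

lemma strict_sup_in_L: "b \<in> L \<Longrightarrow> \<forall>x\<in>X. x < b \<Longrightarrow> strict_sup X \<in> L"
  using downward_closed_le strict_sup_le by blast

lemma atMost_small:
  assumes "x \<in> L"
  shows "|{..x}| <o |L|"
proof -
  obtain y where y: "y \<in> L" "x < y" using assms sequence_bounded[of "\<lambda>_. x"] by blast
  then have "{..x} \<subseteq> {..<y}" by auto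
  then show ?thesis using segment_small[OF y(1)] card_of_mono1 ordLeq_ordLess_trans by blast
qed

lemma card_of_unbounded:
  assumes "X \<subseteq> L" "\<And>b. b \<in> L \<Longrightarrow> \<exists>x\<in>X. b \<le> x"
  shows "|L| \<le>o |X|"
proof (rule ccontr)
  assume "\<not> |L| \<le>o |X|"
  then have "|X| <o |L|" by (simp add: not_ordLeq_iff_ordLess card_of_Well_order)
  then obtain b where "b \<in> L" "\<forall>x\<in>X. x < b" using bounded_if_small[OF assms(1)] by blast
  then show False using assms(2)[of b] by fastforce
qed

definition self_map :: "('a \<Rightarrow> 'a) \<Rightarrow> bool" where
  "self_map h \<longleftrightarrow> (\<forall>x\<in>L. h x \<in> L)"

lemma pointwise_bound:
  assumes "|I| <o |L|" "\<And>i. i \<in> I \<Longrightarrow> self_map (h i)"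
  shows "\<exists>g. self_map g \<and> (\<forall>i\<in>I. \<forall>x\<in>L. h i x < g x)"
proof -
  have "\<forall>x\<in>L. \<exists>b. b \<in> L \<and> (\<forall>i\<in>I. h i x < b)"
    using image_bounded[OF assms(1), of "\<lambda>i. h i x" for x] assms(2) unfolding self_map_def by blast
  then obtain g where "\<forall>x\<in>L. g x \<in> L \<and> (\<forall>i\<in>I. h i x < g x)" by metis
  then show ?thesis unfolding self_map_def by blast
qed

lemma diagonal_bound:
  assumes h: "\<And>a. a \<in> L \<Longrightarrow> self_map (h a)"
  shows "\<exists>g. self_map g \<and> (\<forall>u\<in>L. \<forall>a\<le>u. \<forall>x\<le>u. h a x < g u)"
proof -
  have "\<exists>b\<in>L. \<forall>a\<le>u. \<forall>x\<le>u. h a x < b" if u: "u \<in> L" for u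
  proof -
    have "{..u} \<subseteq> L" using downward_closed_le[OF u] by auto
    then obtain g where g: "self_map g" "\<forall>a\<in>{..u}. \<forall>x\<in>L. h a x < g x"
      using pointwise_bound[OF atMost_small[OF u], of h] h by blast
    then obtain b where "b \<in> L" "\<forall>x\<in>{..u}. g x < b"
      using image_bounded[OF atMost_small[OF u], of g] \<open>{..u} \<subseteq> L\<close> unfolding self_map_def by blast
    moreover have "h a x < g x" if "a \<le> u" "x \<le> u" for a x
      using g(2) that \<open>{..u} \<subseteq> L\<close> by auto
    ultimately show ?thesis by (meson atMost_iff less_trans)
  qed
  then obtain g where "\<forall>u\<in>L. g u \<in> L \<and> (\<forall>a\<le>u. \<forall>x\<le>u. h a x < g u)" by metis
  then show ?thesis unfolding self_map_def by blast
qed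

text \<open>Every club contains a set of this form.\<close>

definition closure_points :: "('a \<Rightarrow> 'a) \<Rightarrow> 'a set" where
  "closure_points h = {y \<in> L. \<forall>x<y. h x < y}"

lemma closure_points_antimono:
  assumes "\<And>x. x \<in> L \<Longrightarrow> g x \<le> h x"
  shows "closure_points h \<subseteq> closure_points g"
proof
  fix y assume y: "y \<in> closure_points h"
  have "g x < y" if "x < y" for x
  proof -
    have "g x \<le> h x"
      using y that by (auto simp: closure_points_def intro!: assms intro: downward_closed)
    also have "h x < y" using that y unfolding closure_points_def by simp
    finally show ?thesis .
  qed
  then show "y \<in> closure_points g" using y unfolding closure_points_def by simp
qed

lemma strict_sup_in_closure_points:
  assumes b: "b \<in> L" "\<forall>x\<in>X. x < b" and closed: "\<And>x. x \<in> X \<Longrightarrow> \<exists>x'\<in>X. \<forall>u\<le>x. h u < x'"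
  shows "strict_sup X \<in> closure_points h"
proof -
  have "h u < strict_sup X" if u: "u < strict_sup X" for u
  proof -
    obtain x where "x \<in> X" "u \<le> x" using less_strict_supD[OF u] by blast
    then obtain x' where "x' \<in> X" "h u < x'" using closed by blast
    then show ?thesis using less_strict_sup[OF b(2)] by (meson less_trans)
  qed
  then show ?thesis using strict_sup_in_L[OF b] unfolding closure_points_def by blast
qed

definition cofinality_omega :: "'a set" where
  "cofinality_omega = {y \<in> L. \<exists>z. (\<forall>n. z n < y) \<and> order_lim z y}"

definition ladder :: "'a \<Rightarrow> nat \<Rightarrow> 'a" where
  "ladder y = (SOME z. (\<forall>n. z n < y) \<and> order_lim z y)"

lemma cofinality_omega_subset: "cofinality_omega \<subseteq> L"
  by (auto simp: cofinality_omega_def)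

lemma
  assumes "y \<in> cofinality_omega"
  shows ladder_less: "ladder y n < y" and order_lim_ladder: "order_lim (ladder y) y"
  using assms someI_ex[of "\<lambda>z. (\<forall>n. z n < y) \<and> order_lim z y"]
  unfolding cofinality_omega_def ladder_def by blast+

lemma ladder_in_L: "y \<in> cofinality_omega \<Longrightarrow> ladder y n \<in> L"
  using ladder_less cofinality_omega_subset downward_closed by blast

lemma strict_sup_range_cofinality_omega:
  fixes z :: "nat \<Rightarrow> 'a"
  assumes "strict_mono z" "b \<in> L" "\<forall>n. z n < b"
  shows "strict_sup (range z) \<in> cofinality_omega"
  using order_lim_strict_sup[OF assms(1,3)] strict_sup_in_L[of b "range z"]
    less_strict_sup[of "range z" b] assms(2,3)
  unfolding cofinality_omega_def by blast

lemma closure_points_unbounded: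
  assumes h: "self_map h" and a: "a \<in> L"
  shows "\<exists>y\<in>closure_points h \<inter> cofinality_omega. a < y"
proof -
  have "\<exists>v\<in>L. u < v \<and> (\<forall>x\<le>u. h x < v)" if u: "u \<in> L" for u
  proof -
    have "max u (h x) \<in> L" if "x \<in> {..u}" for x
      using that h u downward_closed_le[OF u, of x] by (auto simp: self_map_def max_def)
    then obtain b where "b \<in> L" "\<forall>x\<in>{..u}. max u (h x) < b"
      using image_bounded[OF atMost_small[OF u], of "\<lambda>x. max u (h x)"] by blast
    then show ?thesis by (intro bexI[of _ b]) auto
  qed
  then obtain z where z: "z 0 = a" "\<And>n. z n \<in> L" "\<And>n. z n < z (Suc n)"
    and closed: "\<And>n x. x \<le> z n \<Longrightarrow> h x < z (Suc n)"
    using omega_chain[OF a, of "\<lambda>u v. u < v \<and> (\<forall>x\<le>u. h x < v)"] by blast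
  obtain b where b: "b \<in> L" "\<forall>n. z n < b" using sequence_bounded[of z] z(2) by blast
  have "strict_mono z" using z(3) by (simp add: strict_mono_Suc_iff)
  then have "strict_sup (range z) \<in> cofinality_omega"
    using b by (rule strict_sup_range_cofinality_omega)
  moreover have "strict_sup (range z) \<in> closure_points h"
    by (rule strict_sup_in_closure_points[OF b(1)]) (use b(2) closed in blast)+
  moreover have "a < strict_sup (range z)" using less_strict_sup[of "range z" b a] b(2) z(1) by auto
  ultimately show ?thesis by blast
qed

definition stationary :: "'a set \<Rightarrow> bool" where
  "stationary S \<longleftrightarrow> (\<forall>h. self_map h \<longrightarrow> closure_points h \<inter> S \<noteq> {})"

lemma stationaryD: "stationary S \<Longrightarrow> self_map h \<Longrightarrow> \<exists>y\<in>S. y \<in> closure_points h"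
  unfolding stationary_def by blast

lemma not_stationary_iff: "\<not> stationary S \<longleftrightarrow> (\<exists>h. self_map h \<and> closure_points h \<inter> S = {})"
  unfolding stationary_def by blast

lemma Fodor:
  assumes S: "stationary S" and regressive: "\<And>y. y \<in> S \<Longrightarrow> f y < y"
  shows "\<exists>a. stationary {y \<in> S. f y = a}"
proof (rule ccontr)
  assume "\<not> ?thesis"
  then have "\<forall>a. \<exists>h. self_map h \<and> closure_points h \<inter> {y \<in> S. f y = a} = {}"
    by (simp add: not_stationary_iff)
  then obtain h where h: "\<And>a. self_map (h a)"
    and avoids: "\<And>a. closure_points (h a) \<inter> {y \<in> S. f y = a} = {}" by metis
  obtain g where g: "self_map g" "\<forall>u\<in>L. \<forall>a\<le>u. \<forall>x\<le>u. h a x < g u"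
    using diagonal_bound[of h] h by blast
  obtain y where y: "y \<in> closure_points g" "y \<in> S" using stationaryD[OF S g(1)] by blast
  have "h (f y) x < y" if "x < y" for x
  proof -
    have "max (f y) x < y" using regressive[OF y(2)] that by simp
    then have "max (f y) x \<in> L" "g (max (f y) x) < y"
      using y(1) downward_closed unfolding closure_points_def by blast+
    moreover have "h (f y) x < g (max (f y) x)" using g(2) calculation(1) by simp
    ultimately show ?thesis by simp
  qed
  then have "y \<in> closure_points (h (f y))" using y(1) unfolding closure_points_def by blast
  then show False using avoids[of "f y"] y(2) by blast
qed

lemma stationary_ladder_entry_ge:
  "\<exists>n. \<forall>c\<in>L. stationary {y \<in> cofinality_omega. c \<le> ladder y n}"
proof (rule ccontr)
  assume "\<not> ?thesis"
  then have "\<forall>n. \<exists>c\<in>L. \<exists>h. self_map h \<and>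
      closure_points h \<inter> {y \<in> cofinality_omega. c \<le> ladder y n} = {}"
    by (simp add: not_stationary_iff)
  then obtain c h where c: "\<And>n. c n \<in> L" and h: "\<And>n. self_map (h n)"
    and avoids: "\<And>n. closure_points (h n) \<inter> {y \<in> cofinality_omega. c n \<le> ladder y n} = {}" by metis
  obtain b where b: "b \<in> L" "\<forall>n. c n < b" using sequence_bounded[of c] c by blast
  obtain g where g: "self_map g" "\<forall>n\<in>UNIV. \<forall>x\<in>L. h n x < g x"
    using pointwise_bound[OF nat_set_small, of UNIV h] h by blast
  obtain y where y: "y \<in> closure_points g" "y \<in> cofinality_omega" "b < y"
    using closure_points_unbounded[OF g(1) b(1)] by blast
  have "\<forall>\<^sub>F n in sequentially. b < ladder y n"
    using order_lim_ladder[OF y(2)] y(3) unfolding order_lim_def by blast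
  then obtain n where n: "b < ladder y n" using eventually_happens'[OF sequentially_bot] by blast
  have "closure_points g \<subseteq> closure_points (h n)"
    by (rule closure_points_antimono) (use g(2) in \<open>simp add: less_imp_le\<close>)
  then have "ladder y n < c n" using avoids[of n] y(1,2) by (auto simp: not_le[symmetric])
  also have "c n < b" using b(2) by blast
  finally show False using n by simp
qed

text \<open>Solovay's splitting of \<open>cofinality_omega\<close>.\<close>

lemma stationary_splitting:
  "\<exists>n. |L| \<le>o |{a \<in> L. stationary {y \<in> cofinality_omega. ladder y n = a}}|"
proof -
  obtain n where n: "\<And>c. c \<in> L \<Longrightarrow> stationary {y \<in> cofinality_omega. c \<le> ladder y n}"
    using stationary_ladder_entry_ge by blast
  have "\<exists>a\<in>{a \<in> L. stationary {y \<in> cofinality_omega. ladder y n = a}}. c \<le> a" if c: "c \<in> L" for c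
  proof -
    let ?S = "\<lambda>a. {y \<in> {y \<in> cofinality_omega. c \<le> ladder y n}. ladder y n = a}"
    obtain a where a: "stationary (?S a)"
      using Fodor[OF n[OF c], of "\<lambda>y. ladder y n"] ladder_less by blast
    obtain y where "y \<in> ?S a" using stationaryD[OF a, of id] by (auto simp: self_map_def)
    then have "c \<le> a" "a \<in> L" using ladder_in_L by auto
    moreover have "stationary {y \<in> cofinality_omega. ladder y n = a}"
      using a unfolding stationary_def by blast
    ultimately show ?thesis by blast
  qed
  then show ?thesis by (intro exI card_of_unbounded) auto
qed

end

section \<open>Guessing clubs\<close>

context regular_uncountable
begin

definition guessing_family :: "'m set \<Rightarrow> ('m \<Rightarrow> 'a) set \<Rightarrow> bool" where
  "guessing_family M C \<longleftrightarrow> |C| \<le>o |L| \<and> (\<forall>c\<in>C. inj_on c M \<and> c ` M \<subseteq> cofinality_omega) \<and>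
    (\<forall>h. self_map h \<longrightarrow> (\<exists>c\<in>C. c ` M \<subseteq> closure_points h))"

lemma successor_point_ex:
  assumes "cardSuc |M| <o |L|"
  shows "\<exists>\<tau>\<in>L. |M| <o |{..<\<tau>}| \<and> (\<forall>i<\<tau>. |{..<i}| \<le>o |M| )"
proof -
  let ?F = "Field (cardSuc |M| )"
  have F: "|?F| =o cardSuc |M|"
    by (simp add: card_of_Field_ordIso cardSuc_Card_order card_of_Card_order)
  have FL: "|?F| <o |L|" using F assms by (rule ordIso_ordLess_trans)
  obtain f where f: "inj_on f ?F" "f ` ?F \<subseteq> L"
    using ordLess_imp_ordLeq[OF FL] by (rule card_of_ordLeqE)
  obtain b where b: "b \<in> L" "\<forall>x\<in>?F. f x < b" using image_bounded[OF FL, of f] f(2) by blast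
  have "|M| <o cardSuc |M|" by (simp add: cardSuc_greater card_of_Card_order)
  also have "cardSuc |M| =o |?F|" using F by (rule ordIso_symmetric)
  also have "|?F| \<le>o |{..<b}|" by (rule card_of_ordLeqI[of f]) (use f(1) b(2) in auto)
  finally have Mb: "|M| <o |{..<b}|" .
  define \<tau> :: 'a where "\<tau> = (LEAST t. |M| <o |{..<t}| )"
  have "|M| <o |{..<\<tau>}|" unfolding \<tau>_def using Mb by (rule LeastI)
  moreover have "\<tau> \<le> b" unfolding \<tau>_def using Mb by (rule Least_le)
  then have "\<tau> \<in> L" using b(1) downward_closed_le by blast
  moreover have "|{..<i}| \<le>o |M|" if "i < \<tau>" for i
  proof -
    have "\<not> |M| <o |{..<i}|" using that not_less_Least unfolding \<tau>_def by blast
    then show ?thesis by (simp add: not_ordLess_iff_ordLeq card_of_Well_order)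
  qed
  ultimately show ?thesis by blast
qed

end

text \<open>The point \<open>\<tau>\<close> plays the role of the ordinal \<open>|M|\<^sup>+\<close>.\<close>

locale successor_point = regular_uncountable L for L :: "'a::wellorder set" +
  fixes M :: "'m set" and \<tau> :: 'a
  assumes infinite_M: "infinite M" and \<tau>_in_L: "\<tau> \<in> L"
    and M_less: "|M| <o |{..<\<tau>}|"
    and card_of_below_\<tau>: "i < \<tau> \<Longrightarrow> |{..<i}| \<le>o |M|"
begin

lemma Cinfinite_M: "Cinfinite |M|"
  using infinite_M by (simp add: Cinfinite_card_of_iff)

lemma bounded_below_\<tau>:
  assumes X: "X \<subseteq> {..<\<tau>}" "|X| \<le>o |M|"
  shows "\<exists>j<\<tau>. \<forall>x\<in>X. x < j"
proof (rule ccontr)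
  assume "\<not> ?thesis"
  then have "{..<\<tau>} \<subseteq> (\<Union>x\<in>X. {..<x} \<union> {x})" by (fastforce simp: not_less)
  then have "|{..<\<tau>}| \<le>o |\<Union>x\<in>X. {..<x} \<union> {x}|" by (rule card_of_mono1)
  also have "|\<Union>x\<in>X. {..<x} \<union> {x}| \<le>o |M|"
  proof (rule UNION_Cinfinite_bound[OF X(2) ballI Cinfinite_M])
    fix x assume "x \<in> X"
    then have "|{..<x}| \<le>o |M|" using X(1) card_of_below_\<tau> by blast
    then show "|{..<x} \<union> {x}| \<le>o |M|"
      using card_of_subsingleton_bound[OF Cinfinite_M, of "{x}"] Cinfinite_M
      by (intro Un_Cinfinite_bound) auto
  qed
  finally show False using M_less not_ordLess_ordLeq by blast
qed

lemma less_successor_below_\<tau>: "i < \<tau> \<Longrightarrow> \<exists>j<\<tau>. i < j"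
  using bounded_below_\<tau>[of "{i}"] card_of_subsingleton_bound[OF Cinfinite_M, of "{i}"] by auto

lemma unbounded_below_\<tau>_initial_part:
  assumes P: "P \<subseteq> {..<\<tau>}" and unbounded: "\<And>i. i < \<tau> \<Longrightarrow> \<exists>p\<in>P. i < p"
  shows "\<exists>j<\<tau>. |M| \<le>o |P \<inter> {..<j}|"
proof -
  have "\<not> |P| \<le>o |M|"
  proof
    assume "|P| \<le>o |M|"
    then obtain j where j: "j < \<tau>" "\<forall>p\<in>P. p < j" using bounded_below_\<tau>[OF P] by blast
    then show False using unbounded[of j] by (meson less_asym)
  qed
  then have "|M| \<le>o |P|" by (simp add: not_ordLeq_iff_ordLess card_of_Well_order ordLess_imp_ordLeq)
  then obtain f where f: "inj_on f M" "f ` M \<subseteq> P" by (rule card_of_ordLeqE)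
  then obtain j where "j < \<tau>" "\<forall>x\<in>f ` M. x < j"
    using bounded_below_\<tau>[of "f ` M"] P card_of_image[of f M] by blast
  then show ?thesis using f card_of_ordLeqI[of f M "P \<inter> {..<j}"] by blast
qed

definition cofinal_seq :: "'a \<Rightarrow> ('a \<Rightarrow> 'a) \<Rightarrow> bool" where
  "cofinal_seq \<delta> d \<longleftrightarrow> strict_mono_on {..<\<tau>} d \<and> (\<forall>j<\<tau>. d j < \<delta>) \<and> (\<forall>z<\<delta>. \<exists>j<\<tau>. z < d j)"

lemma cofinal_seq_less: "cofinal_seq \<delta> d \<Longrightarrow> i < j \<Longrightarrow> j < \<tau> \<Longrightarrow> d i < d j"
  by (auto simp: cofinal_seq_def strict_mono_on_def)

lemma cofinal_seq_le: "cofinal_seq \<delta> d \<Longrightarrow> i \<le> j \<Longrightarrow> j < \<tau> \<Longrightarrow> d i \<le> d j"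
  using cofinal_seq_less[of \<delta> d i j] by (auto simp: le_less)

lemma cofinal_seq_of_closure_points:
  assumes h: "self_map h"
  shows "\<exists>\<delta>\<in>L. \<exists>x. cofinal_seq \<delta> x \<and> x ` {..<\<tau>} \<subseteq> closure_points h"
proof -
  have "\<exists>y\<in>closure_points h. \<forall>k<i. F k < y"
    if i: "i < \<tau>" and F: "F ` {..<i} \<subseteq> closure_points h" for i F
  proof -
    have "|{..<i}| <o |L|" using segment_small downward_closed[OF \<tau>_in_L i] by blast
    moreover have "F ` {..<i} \<subseteq> L" using F unfolding closure_points_def by blast
    ultimately obtain b where b: "b \<in> L" "\<forall>k\<in>{..<i}. F k < b"
      using image_bounded[of "{..<i}" F] by blast
    obtain y where "y \<in> closure_points h" "b < y" using closure_points_unbounded[OF h b(1)] by blast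
    then show ?thesis using b(2) by (meson lessThan_iff less_trans)
  qed
  then obtain x where x: "\<forall>i<\<tau>. x i \<in> closure_points h \<and> (\<forall>k<i. x k < x i)"
    using transfinite_chain[of \<tau> "closure_points h" "(<)"] by blast
  then have "x ` {..<\<tau>} \<subseteq> L" unfolding closure_points_def by auto
  then obtain b where b: "b \<in> L" "\<forall>z\<in>x ` {..<\<tau>}. z < b"
    using image_bounded[OF segment_small[OF \<tau>_in_L], of x] by blast
  let ?\<delta> = "strict_sup (x ` {..<\<tau>})"
  have "\<exists>j<\<tau>. z < x j" if z: "z < ?\<delta>" for z
  proof -
    obtain i where i: "i < \<tau>" "z \<le> x i" using less_strict_supD[OF z] by blast
    obtain j where "j < \<tau>" "i < j" using less_successor_below_\<tau>[OF i(1)] by blast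
    then show ?thesis using x i(2) by (meson le_less_trans)
  qed
  then have "cofinal_seq ?\<delta> x"
    using x less_strict_sup[OF b(2)] by (auto simp: cofinal_seq_def strict_mono_on_def)
  then show ?thesis using strict_sup_in_L[OF b] x by blast
qed

lemma cofinal_seqs_interleave:
  assumes d: "cofinal_seq \<delta> d" and x: "cofinal_seq \<delta> x" and i: "i < \<tau>"
  shows "\<exists>i'<\<tau>. i < i' \<and> (\<exists>k<\<tau>. d i < x k \<and> x k < d i')"
proof -
  have "d i < \<delta>" using d i unfolding cofinal_seq_def by blast
  then obtain k where k: "k < \<tau>" "d i < x k" using x unfolding cofinal_seq_def by blast
  then have "x k < \<delta>" using x unfolding cofinal_seq_def by blast
  then obtain i' where i': "i' < \<tau>" "x k < d i'" using d unfolding cofinal_seq_def by blast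
  have "i < i'"
  proof (rule ccontr)
    assume "\<not> i < i'"
    then have "d i' \<le> d i" using cofinal_seq_le[OF d _ i] by simp
    then show False using k(2) i'(2) by simp
  qed
  then show ?thesis using k i' by blast
qed

lemma cofinal_seq_interleaving_chain:
  assumes d: "cofinal_seq \<delta> d" and x: "cofinal_seq \<delta> x" "x ` {..<\<tau>} \<subseteq> Y" and i: "i < \<tau>"
  shows "\<exists>s. s 0 = i \<and>
    (\<forall>n :: nat. s n < \<tau> \<and> s n < s (Suc n) \<and> (\<exists>y\<in>Y. d (s n) < y \<and> y < d (s (Suc n))))"
proof -
  let ?R = "\<lambda>k k'. k < k' \<and> (\<exists>y\<in>Y. d k < y \<and> y < d k')"
  have "\<exists>k'\<in>{..<\<tau>}. ?R k k'" if k: "k \<in> {..<\<tau>}" for k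
  proof -
    obtain k' i' where "k' < \<tau>" "k < k'" "i' < \<tau>" "d k < x i'" "x i' < d k'"
      using cofinal_seqs_interleave[OF d x(1), of k] k unfolding lessThan_iff by blast
    moreover have "x i' \<in> Y" using x(2) calculation(3) by auto
    ultimately show ?thesis by blast
  qed
  then show ?thesis using omega_chain[of i "{..<\<tau>}" ?R] i unfolding lessThan_iff by blast
qed

definition club_seq :: "'a \<Rightarrow> 'a \<Rightarrow> 'a" where
  "club_seq \<delta> = (SOME d. cofinal_seq \<delta> d)"

definition club_point :: "'a \<Rightarrow> 'a \<Rightarrow> 'a" where
  "club_point \<delta> i = strict_sup (club_seq \<delta> ` {..<i})"

lemma cofinal_seq_club_seq: "cofinal_seq \<delta> d \<Longrightarrow> cofinal_seq \<delta> (club_seq \<delta>)"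
  unfolding club_seq_def by (rule someI[of "cofinal_seq \<delta>"])

lemma club_point_inj_on:
  assumes d: "cofinal_seq \<delta> (club_seq \<delta>)"
  shows "inj_on (club_point \<delta>) {..<\<tau>}"
proof (rule strict_mono_on_imp_inj_on, rule strict_mono_onI)
  fix i j assume ij: "i \<in> {..<\<tau>}" "j \<in> {..<\<tau>}" "i < j"
  have "club_point \<delta> i \<le> club_seq \<delta> i"
    unfolding club_point_def using cofinal_seq_less[OF d] ij by (intro strict_sup_le) auto
  also have "club_seq \<delta> i < club_point \<delta> j"
    unfolding club_point_def
    by (rule less_strict_sup[of _ "club_seq \<delta> j"]) (use cofinal_seq_less[OF d] ij in auto)
  finally show "club_point \<delta> i < club_point \<delta> j" .
qed

lemma club_point_strict_sup:
  assumes d: "cofinal_seq \<delta> (club_seq \<delta>)" and s: "\<forall>n. s n < b" "b < \<tau>"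
  shows "club_point \<delta> (strict_sup (range s)) = strict_sup (range (\<lambda>n :: nat. club_seq \<delta> (s n)))"
  unfolding club_point_def
proof (rule strict_sup_eq_if_cofinal)
  have s_less: "s n < strict_sup (range s)" for n
    using less_strict_sup[of "range s" b] s(1) by blast
  show "\<forall>z\<in>range (\<lambda>n. club_seq \<delta> (s n)). \<exists>y\<in>club_seq \<delta> ` {..<strict_sup (range s)}. z \<le> y"
    using s_less by blast
  show "\<forall>z\<in>club_seq \<delta> ` {..<strict_sup (range s)}. \<exists>y\<in>range (\<lambda>n. club_seq \<delta> (s n)). z \<le> y"
  proof
    fix z assume "z \<in> club_seq \<delta> ` {..<strict_sup (range s)}"
    then obtain k n where k: "z = club_seq \<delta> k" "k \<le> s n" using less_strict_supD by blast
    moreover have "s n < \<tau>" using s less_trans by blast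
    ultimately have "z \<le> club_seq \<delta> (s n)" using cofinal_seq_le[OF d] by blast
    then show "\<exists>y\<in>range (\<lambda>n. club_seq \<delta> (s n)). z \<le> y" by blast
  qed
qed

lemma club_points_in_closure_points_unbounded:
  assumes \<delta>: "\<delta> \<in> L" and x: "cofinal_seq \<delta> x" "x ` {..<\<tau>} \<subseteq> closure_points h" and i: "i < \<tau>"
  shows "\<exists>w<\<tau>. i < w \<and> club_point \<delta> w \<in> closure_points h \<inter> cofinality_omega"
proof -
  let ?d = "club_seq \<delta>"
  have d: "cofinal_seq \<delta> ?d" using x(1) by (rule cofinal_seq_club_seq)
  obtain s where s: "s 0 = i" "\<And>n. s n < \<tau>" "\<And>n. s n < s (Suc n)"
    and between: "\<And>n. \<exists>y\<in>closure_points h. ?d (s n) < y \<and> y < ?d (s (Suc n))"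
    using cofinal_seq_interleaving_chain[OF d x i] by blast
  have "|range s| \<le>o |M|" using card_of_nat_bound[OF Cinfinite_M] by (rule card_of_image_bound)
  then obtain b where b: "b < \<tau>" "\<forall>n. s n < b" using bounded_below_\<tau>[of "range s"] s(2) by blast
  define w where "w = strict_sup (range s)"
  have w: "w < \<tau>" "i < w"
    using strict_sup_le[of "range s" b] less_strict_sup[of "range s" b "s 0"] b s(1)
    by (auto simp: w_def)
  have point: "club_point \<delta> w = strict_sup (range (\<lambda>n. ?d (s n)))"
    unfolding w_def using d b(2,1) by (rule club_point_strict_sup)
  have less: "\<forall>n. ?d (s n) < \<delta>" using d s(2) unfolding cofinal_seq_def by blast
  have "strict_mono (\<lambda>n. ?d (s n))"
    using cofinal_seq_less[OF d] s(2,3) by (simp add: strict_mono_Suc_iff)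
  then have "club_point \<delta> w \<in> cofinality_omega"
    unfolding point using \<delta> less by (rule strict_sup_range_cofinality_omega)
  moreover have "club_point \<delta> w \<in> closure_points h"
    unfolding point
  proof (rule strict_sup_in_closure_points[OF \<delta>])
    fix z assume "z \<in> range (\<lambda>n. ?d (s n))"
    then obtain n y where "z = ?d (s n)" "y \<in> closure_points h" "?d (s n) < y" "y < ?d (s (Suc n))"
      using between by blast
    then have "\<forall>u\<le>z. h u < ?d (s (Suc n))"
      by (auto simp: closure_points_def intro: less_trans dest: le_less_trans)
    then show "\<exists>z'\<in>range (\<lambda>n. ?d (s n)). \<forall>u\<le>z. h u < z'" by blast
  qed (use less in blast)
  ultimately show ?thesis using w by blast
qed

definition club_trace :: "'a \<Rightarrow> 'a \<Rightarrow> ('a \<Rightarrow> 'a) \<Rightarrow> 'a set" where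
  "club_trace \<delta> j g = club_point \<delta> ` {..<j} \<inter> closure_points g \<inter> cofinality_omega"

lemma card_of_club_points:
  assumes "j < \<tau>"
  shows "|club_point \<delta> ` {..<j}| \<le>o |M|"
  using card_of_below_\<tau>[OF assms] by (rule card_of_image_bound)

lemma large_club_trace_ex:
  assumes h: "self_map h"
  shows "\<exists>\<delta>\<in>L. \<exists>j<\<tau>. |M| \<le>o |club_trace \<delta> j h|"
proof -
  obtain \<delta> x where \<delta>: "\<delta> \<in> L" and x: "cofinal_seq \<delta> x" "x ` {..<\<tau>} \<subseteq> closure_points h"
    using cofinal_seq_of_closure_points[OF h] by blast
  let ?P = "{i. i < \<tau> \<and> club_point \<delta> i \<in> closure_points h \<inter> cofinality_omega}"
  have "\<exists>j<\<tau>. |M| \<le>o |?P \<inter> {..<j}|"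
    by (rule unbounded_below_\<tau>_initial_part)
      (use club_points_in_closure_points_unbounded[OF \<delta> x] in blast)+
  then obtain j where j: "j < \<tau>" "|M| \<le>o |?P \<inter> {..<j}|" by blast
  have "inj_on (club_point \<delta>) (?P \<inter> {..<j})"
    using club_point_inj_on[OF cofinal_seq_club_seq[OF x(1)]] by (rule inj_on_subset) auto
  then have "|?P \<inter> {..<j}| \<le>o |club_trace \<delta> j h|"
    by (rule card_of_ordLeqI) (auto simp: club_trace_def)
  then show ?thesis using \<delta> j ordLeq_transitive by blast
qed

definition guesses :: "('a \<Rightarrow> 'a) \<Rightarrow> ('a \<Rightarrow> 'a) \<Rightarrow> bool" where
  "guesses g h \<longleftrightarrow> (\<exists>\<delta>\<in>L. \<exists>j<\<tau>. |M| \<le>o |club_trace \<delta> j g| \<and> club_trace \<delta> j g \<subseteq> closure_points h)"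

definition unguessed_refinements :: "(('a \<Rightarrow> 'a) \<times> ('a \<Rightarrow> 'a)) set" where
  "unguessed_refinements =
    {(g, r). self_map g \<and> self_map r \<and> (\<forall>x\<in>L. g x \<le> r x) \<and> \<not> guesses g r}"

lemma unguessed_refinement_ex:
  assumes "self_map g" "self_map h" "\<not> guesses g h"
  shows "\<exists>r. (g, r) \<in> unguessed_refinements"
proof -
  let ?r = "\<lambda>x. max (g x) (h x)"
  have "closure_points ?r \<subseteq> closure_points h" by (rule closure_points_antimono) simp
  then have "\<not> guesses g ?r" using assms(3) unfolding guesses_def by blast
  moreover have "self_map ?r" using assms(1,2) by (auto simp: self_map_def max_def)
  ultimately have "(g, ?r) \<in> unguessed_refinements"
    using assms(1) by (simp add: unguessed_refinements_def)
  then show ?thesis by blast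
qed

text \<open>Along such a chain, the trace of the clubs on one fixed set of at most \<open>|M|\<close> points would
  shrink strictly at every step.\<close>

lemma no_unguessed_refinement_chain:
  assumes pair: "\<And>j. j < \<tau> \<Longrightarrow> (g j, r j) \<in> unguessed_refinements"
    and chain: "\<And>i j x. j < \<tau> \<Longrightarrow> i < j \<Longrightarrow> x \<in> L \<Longrightarrow> r i x \<le> g j x"
  shows False
proof -
  have "self_map (r j)" if "j \<in> {..<\<tau>}" for j
    using pair that unfolding unguessed_refinements_def by blast
  then obtain G where G: "self_map G" "\<forall>j\<in>{..<\<tau>}. \<forall>x\<in>L. r j x < G x"
    using pointwise_bound[OF segment_small[OF \<tau>_in_L], of r] by blast
  obtain \<delta> j where \<delta>: "\<delta> \<in> L" "j < \<tau>" "|M| \<le>o |club_trace \<delta> j G|"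
    using large_club_trace_ex[OF G(1)] by blast
  have "\<exists>a\<in>club_trace \<delta> j (g i). a \<notin> closure_points (r i)" if i: "i < \<tau>" for i
  proof -
    have "g i x \<le> G x" if x: "x \<in> L" for x
    proof -
      have "g i x \<le> r i x" using pair[OF i] x unfolding unguessed_refinements_def by blast
      also have "r i x \<le> G x" using G(2) i x by (simp add: less_imp_le)
      finally show ?thesis .
    qed
    then have "club_trace \<delta> j G \<subseteq> club_trace \<delta> j (g i)"
      using closure_points_antimono[of "g i" G] unfolding club_trace_def by blast
    then have "|M| \<le>o |club_trace \<delta> j (g i)|" using \<delta>(3) card_of_mono1 ordLeq_transitive by blast
    then show ?thesis
      using pair[OF i] \<delta>(1,2) unfolding unguessed_refinements_def guesses_def by blast
  qed
  then obtain a where a: "\<And>i. i < \<tau> \<Longrightarrow> a i \<in> club_trace \<delta> j (g i) \<and> a i \<notin> closure_points (r i)"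
    by metis
  have "a i \<noteq> a k" if "i < k" "k < \<tau>" for i k
  proof -
    have "closure_points (g k) \<subseteq> closure_points (r i)"
      using chain that by (intro closure_points_antimono) blast
    then show ?thesis using a[of i] a[of k] that by (auto simp: club_trace_def)
  qed
  then have "inj_on a {..<\<tau>}" by (intro inj_onI) (metis lessThan_iff linorder_neqE)
  then have "|{..<\<tau>}| \<le>o |club_point \<delta> ` {..<j}|"
    by (rule card_of_ordLeqI) (use a in \<open>auto simp: club_trace_def\<close>)
  also have "|club_point \<delta> ` {..<j}| \<le>o |M|" using \<delta>(2) by (rule card_of_club_points)
  finally show False using M_less not_ordLess_ordLeq by blast
qed

lemma universal_guesser_ex: "\<exists>g. self_map g \<and> (\<forall>h. self_map h \<longrightarrow> guesses g h)"
proof (rule ccontr)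
  assume none: "\<not> ?thesis"
  let ?R = "\<lambda>p q. \<forall>x\<in>L. snd p x \<le> fst q x"
  have extend: "\<exists>q\<in>unguessed_refinements. \<forall>k<j. ?R (F k) q"
    if j: "j < \<tau>" and F: "F ` {..<j} \<subseteq> unguessed_refinements" for j F
  proof -
    have "|{..<j}| <o |L|" using segment_small downward_closed[OF \<tau>_in_L j] by blast
    moreover have "self_map (snd (F k))" if "k \<in> {..<j}" for k
    proof -
      have "F k \<in> unguessed_refinements" using F that by blast
      then show ?thesis by (auto simp: unguessed_refinements_def)
    qed
    ultimately obtain g where g: "self_map g" "\<forall>k\<in>{..<j}. \<forall>x\<in>L. snd (F k) x < g x"
      using pointwise_bound[of "{..<j}" "\<lambda>k. snd (F k)"] by blast
    obtain r where "(g, r) \<in> unguessed_refinements" using none g(1) unguessed_refinement_ex by blast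
    then show ?thesis using g(2) by (intro bexI[of _ "(g, r)"]) (simp_all add: less_imp_le)
  qed
  obtain F where "\<forall>j<\<tau>. F j \<in> unguessed_refinements \<and> (\<forall>k<j. ?R (F k) (F j))"
    using transfinite_chain[of \<tau> unguessed_refinements ?R] extend by blast
  then show False using no_unguessed_refinement_chain[of "\<lambda>j. fst (F j)" "\<lambda>j. snd (F j)"] by simp
qed

lemma guessing_family_ex_at_successor_point: "\<exists>C. guessing_family M C"
proof -
  obtain g where g: "\<And>h. self_map h \<Longrightarrow> guesses g h" using universal_guesser_ex by blast
  define B where "B p = club_trace (fst p) (snd p) g" for p
  define P where "P = {p \<in> L \<times> {..<\<tau>}. |M| \<le>o |B p| }"
  define enum where "enum p = (SOME c. bij_betw c M (B p))" for p
  have enum: "bij_betw (enum p) M (B p)" if p: "p \<in> P" for p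
  proof -
    have "|B p| \<le>o |club_point (fst p) ` {..<snd p}|"
      unfolding B_def club_trace_def by (intro card_of_mono1) blast
    also have "|club_point (fst p) ` {..<snd p}| \<le>o |M|"
      using p by (intro card_of_club_points) (auto simp: P_def)
    finally have "|M| =o |B p|" using p by (simp add: P_def ordIso_iff_ordLeq)
    then have "\<exists>c. bij_betw c M (B p)" using card_of_ordIso by blast
    then show ?thesis unfolding enum_def by (rule someI_ex)
  qed
  have "|enum ` P| \<le>o |L|"
    unfolding P_def
    by (intro card_of_image_bound ordLeq_transitive[OF card_of_mono1[OF Collect_subset]]
        Times_Cinfinite_bound Cinfinite_L ordLeq_refl card_of_Card_order
        ordLess_imp_ordLeq[OF segment_small[OF \<tau>_in_L]])
  moreover have "B p \<subseteq> cofinality_omega" for p unfolding B_def club_trace_def by blast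
  then have "inj_on c M \<and> c ` M \<subseteq> cofinality_omega" if "c \<in> enum ` P" for c
    using enum that unfolding bij_betw_def by blast
  moreover have "\<exists>c\<in>enum ` P. c ` M \<subseteq> closure_points h" if h: "self_map h" for h
  proof -
    obtain \<delta> j where "\<delta> \<in> L" "j < \<tau>" "|M| \<le>o |B (\<delta>, j)|" "B (\<delta>, j) \<subseteq> closure_points h"
      using g[OF h] unfolding guesses_def by (auto simp: B_def)
    then obtain p where "p \<in> P" "B p \<subseteq> closure_points h" unfolding P_def by blast
    then show ?thesis using enum by (metis bij_betw_imp_surj_on image_eqI)
  qed
  ultimately show ?thesis unfolding guessing_family_def by blast
qed

end

context regular_uncountable
begin

lemma guessing_family_ex:
  assumes "infinite M" "cardSuc |M| <o |L|"
  shows "\<exists>C. guessing_family M C"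
proof -
  obtain \<tau> where \<tau>: "\<tau> \<in> L" "|M| <o |{..<\<tau>}|" "\<forall>i<\<tau>. |{..<i}| \<le>o |M|"
    using successor_point_ex[OF assms(2)] by blast
  interpret successor_point L M \<tau> by unfold_locales (use assms(1) \<tau> in blast)+
  show ?thesis by (rule guessing_family_ex_at_successor_point)
qed

end

section \<open>Trees of finite sequences with fans\<close>

datatype 'a tree_vertex = Node "'a list" | Apex "nat \<Rightarrow> 'a" | Base "nat \<Rightarrow> 'a" nat

definition branch :: "(nat \<Rightarrow> 'a) \<Rightarrow> nat \<Rightarrow> 'a tree_vertex" where
  "branch z j = Node (map z [0..<j])"

text \<open>The neighbourhood of \<open>Apex t\<close> is a ray, and its vertex of index \<open>2 * n\<close> is joined to the
  branch of the tree of finite sequences which converges to \<open>t n\<close>. Only even indices are used, since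
  otherwise two consecutive base vertices could be adjacent to a common node.\<close>

definition tree_fans :: "'a set \<Rightarrow> ('a \<Rightarrow> nat \<Rightarrow> 'a) \<Rightarrow> (nat \<Rightarrow> 'a) set \<Rightarrow> 'a tree_vertex graph" where
  "tree_fans L lad T =
    (Node ` lists L \<union> (Apex ` T \<union> case_prod Base ` (T \<times> UNIV)),
     {{Node s, Node (s @ [x])} |s x. s \<in> lists L \<and> x \<in> L} \<union> {{Apex t, Base t n} |t n. t \<in> T} \<union>
     {{Base t n, Base t (Suc n)} |t n. t \<in> T} \<union>
     {{Base t (2 * n), branch (lad (t n)) j} |t n j. t \<in> T})"

lemma branch_eq_iff: "branch z i = branch z j \<longleftrightarrow> i = j"
  unfolding branch_def by (metis length_map length_upt minus_nat.diff_0 tree_vertex.inject(1))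

lemma branch_eq_Node_append:
  assumes "branch z j = Node (s @ [x])"
  shows "x = z (length s)"
proof -
  have s: "map z [0..<j] = s @ [x]" using assms by (simp add: branch_def)
  then have "j = Suc (length s)"
    by (metis length_append_singleton length_map length_upt minus_nat.diff_0)
  then show ?thesis using s by simp
qed

lemma branch_in_tree_fans: "(\<And>j. z j \<in> L) \<Longrightarrow> branch z n \<in> verts (tree_fans L lad T)"
  by (auto simp: tree_fans_def branch_def image_iff intro!: bexI[of _ "map z [0..<n]"])

lemma tree_fans_edges:
  "{Apex t, u} \<in> edges (tree_fans L lad T) \<longleftrightarrow> t \<in> T \<and> u \<in> range (Base t)"
  "{Base t m, Apex t'} \<in> edges (tree_fans L lad T) \<longleftrightarrow> t = t' \<and> t \<in> T"
  "{Base t m, Base t' n} \<in> edges (tree_fans L lad T) \<longleftrightarrow> t = t' \<and> t \<in> T \<and> (n = Suc m \<or> m = Suc n)"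
  "{Base t m, Node s} \<in> edges (tree_fans L lad T) \<longleftrightarrow>
    t \<in> T \<and> (\<exists>n j. m = 2 * n \<and> Node s = branch (lad (t n)) j)"
  "{Node s, Base t m} \<in> edges (tree_fans L lad T) \<longleftrightarrow>
    t \<in> T \<and> (\<exists>n j. m = 2 * n \<and> Node s = branch (lad (t n)) j)"
  "{Node s, Apex t} \<notin> edges (tree_fans L lad T)"
  "{Node s, Node s'} \<in> edges (tree_fans L lad T) \<Longrightarrow> (\<exists>x. s' = s @ [x]) \<or> (\<exists>x. s = s' @ [x])"
  by (auto simp: tree_fans_def branch_def doubleton_eq_iff image_iff)

lemma tree_fans_Node_nbh:
  assumes "{Node s, u} \<in> edges (tree_fans L lad T)"
  shows "u = Node (butlast s) \<or> (\<exists>x. u = Node (s @ [x])) \<or> (\<exists>t n. u = Base t (2 * n))"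
  using assms by (cases u) (auto simp: tree_fans_edges(5,6) dest: tree_fans_edges(7))

lemma tree_fans_Base_child_unique:
  assumes "{Base t m, Node (s @ [x])} \<in> edges (tree_fans L lad T)"
    and "{Base t m, Node (s @ [y])} \<in> edges (tree_fans L lad T)"
  shows "x = y"
proof -
  obtain n i j where "m = 2 * n" "Node (s @ [x]) = branch (lad (t n)) i"
    "Node (s @ [y]) = branch (lad (t n)) j"
    using assms unfolding tree_fans_edges(4) by auto
  then show ?thesis by (metis branch_eq_Node_append)
qed

lemma tree_fans_nbh_ray_Node_visits_parent:
  assumes r: "nbh_ray (tree_fans L lad T) (Node s) r"
  shows "Node (butlast s) \<in> range r"
proof (rule ccontr)
  let ?E = "edges (tree_fans L lad T)"
  assume avoids: "Node (butlast s) \<notin> range r"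
  have edge: "{r n, r (Suc n)} \<in> ?E" for n using r by (simp add: nbh_ray_iff)
  have child_or_base: "(\<exists>x. r n = Node (s @ [x])) \<or> (\<exists>t m. r n = Base t (2 * m))" for n
  proof -
    have "r n \<noteq> Node (butlast s)" using avoids by (metis rangeI)
    then show ?thesis using tree_fans_Node_nbh[of s "r n" L lad T] r by (simp add: nbh_ray_iff)
  qed
  have after_base: "\<exists>x. r (Suc n) = Node (s @ [x])" if n: "r n = Base t (2 * m)" for n t m
  proof (rule ccontr)
    assume "\<not> ?thesis"
    then obtain t' m' where "r (Suc n) = Base t' (2 * m')" using child_or_base by blast
    then have "2 * m' = Suc (2 * m) \<or> 2 * m = Suc (2 * m')"
      using edge[of n] n by (simp add: tree_fans_edges(3))
    then show False by presburger
  qed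
  have after_child: "\<exists>t m. r (Suc n) = Base t (2 * m)" if n: "r n = Node (s @ [x])" for n x
  proof (rule ccontr)
    assume "\<not> ?thesis"
    then obtain y where "r (Suc n) = Node (s @ [y])" using child_or_base by blast
    then show False using edge[of n] n by (auto dest: tree_fans_edges(7))
  qed
  obtain n x where x: "r n = Node (s @ [x])" using child_or_base[of 0] after_base[of 0] by blast
  obtain t m where base: "r (Suc n) = Base t (2 * m)" using after_child[OF x] by blast
  obtain y where y: "r (Suc (Suc n)) = Node (s @ [y])" using after_base[OF base] by blast
  have "x = y"
    using edge[of n] edge[of "Suc n"] x base y
      tree_fans_Base_child_unique[of t "2 * m" s x L lad T y] by (simp add: insert_commute)
  then have "r n = r (Suc (Suc n))" using x y by simp
  then show False using r by (simp add: nbh_ray_iff inj_eq)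
qed

lemma tree_fans_no_nbh_ray_Node: "\<not> nbh_ray (tree_fans L lad T) (Node s) r"
proof
  assume r: "nbh_ray (tree_fans L lad T) (Node s) r"
  obtain i where i: "r i = Node (butlast s)"
    using tree_fans_nbh_ray_Node_visits_parent[OF r] by auto
  obtain k where "r (Suc i + k) = Node (butlast s)"
    using tree_fans_nbh_ray_Node_visits_parent[OF nbh_ray_tail[OF r, of "Suc i"]] by auto
  then have "r (Suc i + k) = r i" using i by simp
  then have "Suc i + k = i" using r by (simp add: nbh_ray_iff inj_eq)
  then show False by simp
qed

lemma tree_fans_edge_within_branch:
  assumes "{branch z i, branch z j} \<in> edges (tree_fans L lad T)"
  shows "j = Suc i \<or> i = Suc j"
proof -
  obtain x where "map z [0..<j] = map z [0..<i] @ [x] \<or> map z [0..<i] = map z [0..<j] @ [x]"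
    using assms unfolding branch_def by (blast dest: tree_fans_edges(7))
  then have "length (map z [0..<j]) = Suc (length (map z [0..<i]))
      \<or> length (map z [0..<i]) = Suc (length (map z [0..<j]))" by (metis length_append_singleton)
  then show ?thesis by simp
qed

lemma tree_fans_no_edge_to_branch:
  "{Apex t, branch z j} \<notin> edges (tree_fans L lad T)"
  "odd i \<Longrightarrow> {Base t i, branch z j} \<notin> edges (tree_fans L lad T)"
  by (auto simp: branch_def tree_fans_edges)

lemma tree_fans_nbh_ray_BaseD:
  assumes r: "nbh_ray (tree_fans L lad T) (Base t m) r"
  shows "\<exists>k. m = 2 * k \<and> t \<in> T \<and> (\<exists>j. \<forall>n. r n = branch (lad (t k)) (j + n))"
proof -
  let ?F = "insert (Apex t) (Base t ` {i. i = Suc m \<or> m = Suc i})"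
  let ?B = "{branch (lad (t k)) j |k j. m = 2 * k \<and> t \<in> T}"
  have "range r \<subseteq> ?B"
  proof (rule is_ray_avoids_finite_component[OF nbh_ray_imp_is_ray[OF r]])
    have "{i. i = Suc m \<or> m = Suc i} \<subseteq> {..Suc m}" by auto
    then have "finite {i. i = Suc m \<or> m = Suc i}" by (rule finite_subset) simp
    then show "finite ?F" by simp
  next
    show "range r \<subseteq> ?F \<union> ?B"
    proof
      fix u assume "u \<in> range r"
      then have "{Base t m, u} \<in> edges (tree_fans L lad T)" using r by (auto simp: nbh_ray_iff)
      then show "u \<in> ?F \<union> ?B" by (cases u) (auto simp: tree_fans_edges)
    qed
  next
    fix u w assume u: "u \<in> ?F" and "w \<in> ?B"
    then obtain k j where w: "m = 2 * k" "w = branch (lad (t k)) j" by blast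
    have "even m" using w(1) by simp
    then have "u = Apex t \<or> (\<exists>i. odd i \<and> u = Base t i)" using u by auto
    then show "{u, w} \<notin> edges (tree_fans L lad T)" using w(2) tree_fans_no_edge_to_branch by blast
  qed
  moreover obtain k where k: "m = 2 * k" "t \<in> T" using \<open>range r \<subseteq> ?B\<close> by blast
  ultimately have r_branch: "range r \<subseteq> range (branch (lad (t k)))" by fastforce
  have "\<exists>j. \<forall>n. r n = branch (lad (t k)) (j + n)"
  proof (rule is_ray_along_path[OF nbh_ray_imp_is_ray[OF r] r_branch])
    show "inj (branch (lad (t k)))" by (simp add: inj_on_def branch_eq_iff)
  qed (rule tree_fans_edge_within_branch)
  then show ?thesis using k(1,2) by blast
qed

lemma tree_fans_nbh_ray_ApexD:
  assumes r: "nbh_ray (tree_fans L lad T) (Apex t) r"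
  shows "t \<in> T \<and> (\<exists>j. \<forall>n. r n = Base t (j + n))"
proof -
  have t: "t \<in> T" "range r \<subseteq> range (Base t)" using r by (auto simp: nbh_ray_iff tree_fans_edges(1))
  have "\<exists>j. \<forall>n. r n = Base t (j + n)"
    by (rule is_ray_along_path[OF nbh_ray_imp_is_ray[OF r] t(2)])
      (auto simp: inj_on_def tree_fans_edges(3))
  then show ?thesis using t(1) by blast
qed

lemma tree_fans_nbh_ray_through_hubD:
  assumes r: "nbh_ray (tree_fans L lad T) v r" and q: "nbh_ray (tree_fans L lad T) (r 0) q"
  shows "\<exists>t\<in>T. \<exists>j. \<forall>n. r n = Base t (j + n)"
proof (cases v)
  case (Node s)
  then show ?thesis using r tree_fans_no_nbh_ray_Node by blast
next
  case (Apex t)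
  then show ?thesis using r tree_fans_nbh_ray_ApexD by blast
next
  case (Base t m)
  then obtain z j where "\<forall>n. r n = branch z (j + n)" using r tree_fans_nbh_ray_BaseD by blast
  then have "r 0 = Node (map z [0..<j])" by (simp add: branch_def)
  then show ?thesis using q tree_fans_no_nbh_ray_Node by metis
qed

lemma tree_fans_nbh_ray_Apex:
  "t \<in> T \<Longrightarrow> nbh_ray (tree_fans L lad T) (Apex t) (Base t)"
  by (auto simp: nbh_ray_iff tree_fans_edges inj_on_def) (auto simp: tree_fans_def)

lemma tree_fans_nbh_ray_Base:
  assumes t: "t \<in> T" and L: "\<And>j. lad (t k) j \<in> L"
  shows "nbh_ray (tree_fans L lad T) (Base t (2 * k)) (branch (lad (t k)))"
proof -
  let ?z = "lad (t k)"
  have "{branch ?z n, branch ?z (Suc n)} \<in> edges (tree_fans L lad T)" for n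
  proof -
    have "map ?z [0..<n] \<in> lists L" "?z n \<in> L"
      "{branch ?z n, branch ?z (Suc n)} = {Node (map ?z [0..<n]), Node (map ?z [0..<n] @ [?z n])}"
      using L by (auto simp: branch_def)
    then show ?thesis unfolding tree_fans_def snd_conv by (intro UnI1) blast
  qed
  moreover have "{Base t (2 * k), branch ?z n} \<in> edges (tree_fans L lad T)" for n
    using t by (auto simp: branch_def tree_fans_edges(4))
  ultimately show ?thesis
    using branch_in_tree_fans[OF L] by (simp add: nbh_ray_iff inj_on_def branch_eq_iff)
qed

lemma tree_fans_is_graph:
  assumes L: "\<And>t n j. t \<in> T \<Longrightarrow> lad (t n) j \<in> L"
  shows "is_graph (tree_fans L lad T)"
proof (rule is_graphI)
  let ?V = "verts (tree_fans L lad T)"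
  have fan_verts: "Base t n \<in> ?V" "Apex t \<in> ?V" if "t \<in> T" for t n
    using that by (auto simp: tree_fans_def)
  fix e assume "e \<in> edges (tree_fans L lad T)"
  then consider (tree) s x where "s \<in> lists L" "x \<in> L" "e = {Node s, Node (s @ [x])}"
    | (apex) t n where "t \<in> T" "e = {Apex t, Base t n}"
    | (base) t n where "t \<in> T" "e = {Base t n, Base t (Suc n)}"
    | (branch) t n j where "t \<in> T" "e = {Base t (2 * n), branch (lad (t n)) j}"
    unfolding tree_fans_def by auto
  then show "\<exists>u\<in>?V. \<exists>v\<in>?V. u \<noteq> v \<and> e = {u, v}"
  proof cases
    case (tree s x)
    then have "Node s \<in> ?V" "Node (s @ [x]) \<in> ?V" "Node s \<noteq> Node (s @ [x])"
      by (auto simp: tree_fans_def)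
    then show ?thesis
      by (intro bexI[of _ "Node s"] bexI[of _ "Node (s @ [x])"]) (use tree(3) in simp_all)
  next
    case (apex t n)
    then show ?thesis using fan_verts[OF apex(1)] by blast
  next
    case (base t n)
    moreover have "Base t n \<noteq> Base t (Suc n)" by simp
    ultimately show ?thesis using fan_verts(1)[OF base(1)] by blast
  next
    case (branch t n j)
    have "Base t (2 * n) \<noteq> branch (lad (t n)) j" by (simp add: branch_def)
    moreover have "branch (lad (t n)) j \<in> ?V" using L[OF branch(1)] by (rule branch_in_tree_fans)
    ultimately show ?thesis using branch(2) fan_verts(1)[OF branch(1)] by blast
  qed
qed

lemma tree_fans_in_class_G:
  assumes "\<And>t n j. t \<in> T \<Longrightarrow> lad (t n) j \<in> L"
  shows "tree_fans L lad T \<in> class_G"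
proof (rule class_GI)
  show "is_graph (tree_fans L lad T)" using assms by (rule tree_fans_is_graph)
  fix v r s assume r: "nbh_ray (tree_fans L lad T) v r" and s: "nbh_ray (tree_fans L lad T) v s"
  show "tail_equivalent r s"
  proof (cases v)
    case (Node u)
    then show ?thesis using r tree_fans_no_nbh_ray_Node by blast
  next
    case (Apex t)
    then show ?thesis
      using r s by (auto dest!: tree_fans_nbh_ray_ApexD intro: tail_equivalent_tails)
  next
    case (Base t m)
    then show ?thesis
      using r s by (auto dest!: tree_fans_nbh_ray_BaseD intro: tail_equivalent_tails)
  qed
qed

lemma card_of_tree_fans:
  assumes L: "Cinfinite |L|" and T: "|T| \<le>o |L|"
  shows "|verts (tree_fans L lad T)| =o |L|"
proof -
  have "|verts (tree_fans L lad T)| \<le>o |L|"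
    unfolding tree_fans_def fst_conv
    by (intro Un_Cinfinite_bound card_of_image_bound Times_Cinfinite_bound card_of_nat_bound
        card_of_lists_le T L)
  moreover have "|L| \<le>o |verts (tree_fans L lad T)|"
    by (rule card_of_ordLeqI[of "\<lambda>x. Node [x]"]) (auto simp: tree_fans_def inj_on_def)
  ultimately show ?thesis by (simp add: ordIso_iff_ordLeq)
qed

section \<open>Colours coded in every numbering\<close>

definition numbering :: "'a set \<Rightarrow> 'v graph \<Rightarrow> ('v \<Rightarrow> 'a) \<Rightarrow> bool" where
  "numbering L G b \<longleftrightarrow> inj_on b (verts G) \<and> b ` verts G \<subseteq> L"

definition ray_codes :: "'v graph \<Rightarrow> ('v \<Rightarrow> 'a::linorder) \<Rightarrow> (nat \<Rightarrow> 'v) \<Rightarrow> (nat \<Rightarrow> 'a) \<Rightarrow> bool" where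
  "ray_codes G b r t \<longleftrightarrow> (\<forall>n. \<exists>q. nbh_ray G (r (2 * n)) q \<and> order_lim (b \<circ> q) (t n))"

lemma numbering_comp_embedding:
  assumes "graph_embedding f G H" "numbering L H b"
  shows "numbering L G (b \<circ> f)"
proof -
  have f: "inj_on f (verts G)" "f ` verts G \<subseteq> verts H"
    using assms(1) by (auto simp: graph_embedding_def)
  have b: "inj_on b (verts H)" "b ` verts H \<subseteq> L" using assms(2) by (auto simp: numbering_def)
  have "inj_on (b \<circ> f) (verts G)" using f(1) inj_on_subset[OF b(1) f(2)] by (rule comp_inj_on)
  moreover have "(b \<circ> f) ` verts G \<subseteq> L" using f(2) b(2) by (auto simp: image_subset_iff)
  ultimately show ?thesis by (simp add: numbering_def)
qed

lemma ray_codes_embedding: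
  assumes f: "graph_embedding f G H" and "ray_codes G (b \<circ> f) r t"
  shows "ray_codes H b (f \<circ> r) t"
  unfolding ray_codes_def
proof
  fix n
  obtain q where q: "nbh_ray G (r (2 * n)) q" "order_lim (b \<circ> f \<circ> q) (t n)"
    using assms(2) unfolding ray_codes_def by blast
  have "nbh_ray H ((f \<circ> r) (2 * n)) (f \<circ> q)" using nbh_ray_graph_embedding[OF f q(1)] by simp
  then show "\<exists>q. nbh_ray H ((f \<circ> r) (2 * n)) q \<and> order_lim (b \<circ> q) (t n)"
    using q(2) by (auto simp: comp_assoc)
qed

lemma order_lim_nbh_ray_unique:
  assumes "G \<in> class_G"
    and "nbh_ray G v q" "order_lim (b \<circ> q) y" "nbh_ray G v q'" "order_lim (b \<circ> q') y'"
  shows "y = y'"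
proof -
  obtain i j where tails: "\<And>k. q (i + k) = q' (j + k)"
    using class_G_nbh_rays_tail_equivalent[OF assms(1,2,4)] unfolding tail_equivalent_def by blast
  have "order_lim (\<lambda>k. (b \<circ> q) (i + k)) y" using assms(3) by (simp only: order_lim_tail_iff)
  moreover have "order_lim (\<lambda>k. (b \<circ> q) (i + k)) y'"
    using order_lim_tail_iff[of "b \<circ> q'" j y'] assms(5) tails by simp
  ultimately show ?thesis by (rule order_lim_unique)
qed

lemma ray_codes_unique:
  assumes "G \<in> class_G" "ray_codes G b r t" "ray_codes G b r t'"
  shows "t = t'"
proof
  fix n show "t n = t' n" using assms unfolding ray_codes_def by (metis order_lim_nbh_ray_unique)
qed

context regular_uncountable
begin

lemma lists_atMost_small:
  assumes "x \<in> L"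
  shows "|lists {..x}| <o |L|"
proof (cases "finite {..x}")
  case True
  then have "|{..x}| \<le>o natLeq" by (simp add: finite_iff_ordLess_natLeq ordLess_imp_ordLeq)
  then have "|lists {..x}| \<le>o natLeq" using natLeq_Cinfinite by (rule lists_Cinfinite_bound)
  then show ?thesis using uncountable by (rule ordLeq_ordLess_trans)
next
  case False
  then have "|lists {..x}| \<le>o |{..x}|"
    by (simp add: card_of_lists_le Cinfinite_card_of_iff)
  then show ?thesis using atMost_small[OF assms] by (rule ordLeq_ordLess_trans)
qed

lemma list_entries_bounded:
  assumes "s \<in> lists L"
  shows "\<exists>e\<in>L. \<forall>a\<in>set s. a < e"
  using assms by (intro bounded_if_small finite_small) auto

definition controls_list_numbering :: "('a list \<Rightarrow> 'a) \<Rightarrow> ('a \<Rightarrow> 'a) \<Rightarrow> bool" where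
  "controls_list_numbering b h \<longleftrightarrow> (\<forall>x\<in>L. (\<forall>s\<in>lists {..x}. b s < h x) \<and>
    (\<forall>s\<in>lists L. b s \<le> x \<longrightarrow> (\<forall>a\<in>set s. a < h x)))"

lemma controls_list_numbering_ex:
  assumes b: "inj_on b (lists L)" "b ` lists L \<subseteq> L"
  shows "\<exists>h. self_map h \<and> controls_list_numbering b h"
proof -
  obtain e where e: "\<And>s. s \<in> lists L \<Longrightarrow> e s \<in> L" "\<And>s a. s \<in> lists L \<Longrightarrow> a \<in> set s \<Longrightarrow> a < e s"
    using list_entries_bounded by metis
  have "\<exists>c\<in>L. (\<forall>s\<in>lists {..x}. b s < c) \<and> (\<forall>s\<in>lists L. b s \<le> x \<longrightarrow> (\<forall>a\<in>set s. a < c))"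
    if x: "x \<in> L" for x
  proof -
    have "{..x} \<subseteq> L" using downward_closed_le[OF x] by auto
    then have "b s \<in> L" if "s \<in> lists {..x}" for s
      using b(2) that lists_mono[OF \<open>{..x} \<subseteq> L\<close>] by blast
    then obtain c1 where c1: "c1 \<in> L" "\<forall>s\<in>lists {..x}. b s < c1"
      using image_bounded[OF lists_atMost_small[OF x], of b] by blast
    let ?S = "{s \<in> lists L. b s \<le> x}"
    have "inj_on b ?S" using b(1) by (rule inj_on_subset) blast
    then have "|?S| \<le>o |{..x}|" by (rule card_of_ordLeqI) auto
    then have "|?S| <o |L|" using atMost_small[OF x] by (rule ordLeq_ordLess_trans)
    then obtain c2 where c2: "c2 \<in> L" "\<forall>s\<in>?S. e s < c2" using image_bounded[of ?S e] e(1) by blast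
    show ?thesis
    proof (intro bexI[of _ "max c1 c2"] conjI ballI impI)
      show "max c1 c2 \<in> L" using c1(1) c2(1) by (simp add: max_def)
      show "b s < max c1 c2" if "s \<in> lists {..x}" for s
        using c1(2) that by (simp add: less_max_iff_disj)
      show "a < max c1 c2" if "s \<in> lists L" "b s \<le> x" "a \<in> set s" for s a
        using c2(2) e(2)[OF that(1,3)] that(1,2) by (auto simp: less_max_iff_disj intro: less_trans)
    qed
  qed
  then obtain h where "\<forall>x\<in>L. h x \<in> L \<and> (\<forall>s\<in>lists {..x}. b s < h x) \<and>
      (\<forall>s\<in>lists L. b s \<le> x \<longrightarrow> (\<forall>a\<in>set s. a < h x))" by metis
  then show ?thesis unfolding self_map_def controls_list_numbering_def by blast
qed

lemma ladder_initial_list_limit_at: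
  assumes h: "controls_list_numbering b h" and y: "y \<in> closure_points h" "y \<in> cofinality_omega"
  shows "order_lim (\<lambda>j. b (map (ladder y) [0..<j])) y"
proof -
  have below: "x \<in> L" "h x < y" if "x < y" for x
    using y(1) that downward_closed unfolding closure_points_def by auto
  have "b (map (ladder y) [0..<j]) < y" for j
  proof -
    let ?x = "Max (ladder y ` {..j})"
    have x: "?x < y" using ladder_less[OF y(2)] by (subst Max_less_iff) auto
    have "map (ladder y) [0..<j] \<in> lists {..?x}" by (auto intro!: Max_ge)
    then have "b (map (ladder y) [0..<j]) < h ?x"
      using h below(1)[OF x] unfolding controls_list_numbering_def by blast
    also have "h ?x < y" using below(2)[OF x] .
    finally show ?thesis .
  qed
  moreover have "\<forall>\<^sub>F j in sequentially. x < b (map (ladder y) [0..<j])" if x: "x < y" for x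
  proof -
    have "\<forall>\<^sub>F n in sequentially. h x < ladder y n"
      using order_lim_ladder[OF y(2)] below(2)[OF x] unfolding order_lim_def by blast
    then obtain N where N: "h x < ladder y N"
      using eventually_happens'[OF sequentially_bot] by blast
    have "x < b (map (ladder y) [0..<j])" if j: "j \<ge> Suc N" for j
    proof (rule ccontr)
      assume "\<not> ?thesis"
      moreover have "map (ladder y) [0..<j] \<in> lists L" using ladder_in_L[OF y(2)] by auto
      moreover have "ladder y N \<in> set (map (ladder y) [0..<j])" using j by auto
      ultimately have "ladder y N < h x"
        using h below(1)[OF x] unfolding controls_list_numbering_def not_less by blast
      then show False using N by simp
    qed
    then show ?thesis by (rule eventually_sequentiallyI)
  qed
  ultimately show ?thesis unfolding order_lim_def by simp
qed

lemma ladder_initial_list_limit: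
  assumes "inj_on b (lists L)" "b ` lists L \<subseteq> L"
  shows "\<exists>h. self_map h \<and>
    (\<forall>y\<in>closure_points h \<inter> cofinality_omega. order_lim (\<lambda>j. b (map (ladder y) [0..<j])) y)"
  using controls_list_numbering_ex[OF assms] ladder_initial_list_limit_at by blast

lemma tree_fans_branch_limit:
  assumes b: "numbering L (tree_fans L lad T) b"
  shows "\<exists>h. self_map h \<and>
    (\<forall>y\<in>closure_points h \<inter> cofinality_omega. order_lim (b \<circ> branch (ladder y)) y)"
proof -
  have "Node ` lists L \<subseteq> verts (tree_fans L lad T)" by (auto simp: tree_fans_def)
  then have Node: "inj_on b (Node ` lists L)" "b ` Node ` lists L \<subseteq> L"
    using b unfolding numbering_def by (blast intro: inj_on_subset)+
  have "inj_on (b \<circ> Node) (lists L)" by (rule comp_inj_on[OF _ Node(1)]) (simp add: inj_on_def)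
  moreover have "(b \<circ> Node) ` lists L \<subseteq> L" using Node(2) by (simp add: image_comp)
  ultimately show ?thesis
    using ladder_initial_list_limit[of "b \<circ> Node"] by (simp add: comp_def branch_def)
qed

lemma tree_fans_numbering_extension:
  assumes \<nu>: "inj_on \<nu> (lists L)" "\<nu> ` lists L \<subseteq> L" and \<kappa>: "inj_on \<kappa> L" "\<kappa> ` L \<subseteq> L"
    and disjoint: "\<nu> ` lists L \<inter> \<kappa> ` L = {}" and T: "|T| \<le>o |L|"
  shows "\<exists>b. numbering L (tree_fans L lad T) b \<and> (\<forall>s\<in>lists L. b (Node s) = \<nu> s)"
proof -
  define V where "V = Apex ` T \<union> case_prod Base ` (T \<times> (UNIV :: nat set))"
  have "|V| \<le>o |L|"
    unfolding V_def
    by (intro Un_Cinfinite_bound card_of_image_bound Times_Cinfinite_bound card_of_nat_bound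
        T Cinfinite_L)
  then obtain i where i: "inj_on i V" "i ` V \<subseteq> L" by (rule card_of_ordLeqE)
  let ?N = "Node ` lists L" and ?f = "\<lambda>v. case v of Node s \<Rightarrow> \<nu> s"
  let ?b = "\<lambda>v. if v \<in> ?N then ?f v else (\<kappa> \<circ> i) v"
  have "inj_on ?f ?N" using \<nu>(1) by (auto simp: inj_on_def)
  moreover have "inj_on (\<kappa> \<circ> i) V" using i(1) inj_on_subset[OF \<kappa>(1) i(2)] by (rule comp_inj_on)
  moreover have "?f ` ?N \<inter> (\<kappa> \<circ> i) ` V = {}" using disjoint i(2) by fastforce
  ultimately have "inj_on ?b (?N \<union> V)" by (rule inj_on_disjoint_Un)
  moreover have "?b ` (?N \<union> V) \<subseteq> L" using \<nu>(2) \<kappa>(2) i(2) by (auto simp: image_subset_iff)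
  moreover have "verts (tree_fans L lad T) = ?N \<union> V" by (simp add: tree_fans_def V_def)
  ultimately have "numbering L (tree_fans L lad T) ?b" by (simp add: numbering_def)
  then show ?thesis by (intro exI[of _ ?b]) simp
qed

lemma tree_fans_ray_codes_Apex:
  assumes t: "t \<in> T" "range t \<subseteq> cofinality_omega"
    and lim: "\<And>n. order_lim (b \<circ> branch (ladder (t n))) (t n)"
  shows "ray_codes (tree_fans L ladder T) b (Base t) t"
  unfolding ray_codes_def
proof
  fix n
  have "ladder (t n) j \<in> L" for j using t(2) ladder_in_L by blast
  then have "nbh_ray (tree_fans L ladder T) (Base t (2 * n)) (branch (ladder (t n)))"
    by (rule tree_fans_nbh_ray_Base[OF t(1)])
  then show "\<exists>q. nbh_ray (tree_fans L ladder T) (Base t (2 * n)) q \<and> order_lim (b \<circ> q) (t n)"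
    using lim by blast
qed

lemma tree_fans_ray_codesD:
  assumes lim: "\<And>t n. t \<in> T \<Longrightarrow> order_lim (b \<circ> branch (ladder (t n))) (t n)"
    and r: "nbh_ray (tree_fans L ladder T) v r" and t: "ray_codes (tree_fans L ladder T) b r t"
  shows "\<exists>t'\<in>T. tail_equivalent t t'"
proof -
  let ?G = "tree_fans L ladder T"
  obtain q\<^sub>0 where "nbh_ray ?G (r 0) q\<^sub>0"
    using t[unfolded ray_codes_def, rule_format, of 0] by auto
  then obtain t' j where t': "t' \<in> T" and r_base: "\<And>n. r n = Base t' (j + n)"
    using tree_fans_nbh_ray_through_hubD[OF r] by blast
  have entry: "\<exists>m. j + 2 * n = 2 * m \<and> t n = t' m" for n
  proof -
    obtain q where q: "nbh_ray ?G (Base t' (j + 2 * n)) q" "order_lim (b \<circ> q) (t n)"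
      using t unfolding ray_codes_def r_base by blast
    then obtain m i where m: "j + 2 * n = 2 * m"
      and q_branch: "\<And>n. q n = branch (ladder (t' m)) (i + n)"
      using tree_fans_nbh_ray_BaseD by metis
    have "order_lim (\<lambda>n. (b \<circ> branch (ladder (t' m))) (i + n)) (t' m)"
      using lim[OF t'] by (simp only: order_lim_tail_iff)
    then have "order_lim (b \<circ> q) (t' m)" by (simp add: comp_def q_branch)
    then show ?thesis using q(2) m order_lim_unique by blast
  qed
  obtain m where m: "j = 2 * m" using entry[of 0] by auto
  have "t n = t' (m + n)" for n
  proof -
    obtain k where "j + 2 * n = 2 * k" "t n = t' k" using entry by blast
    moreover have "k = m + n" using calculation(1) m by simp
    ultimately show ?thesis by simp
  qed
  then have "tail_equivalent t t'" by (intro tail_equivalent_tails[of _ t' m t' 0]) simp_all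
  then show ?thesis using t' by blast
qed

end

text \<open>The sequences in \<open>Y k\<close> are the codes of the colour \<open>k\<close>.\<close>

locale colour_system = regular_uncountable L for L :: "'a::wellorder set" +
  fixes K :: "'k set" and Y :: "'k \<Rightarrow> (nat \<Rightarrow> 'a) set"
  assumes card_of_Y: "k \<in> K \<Longrightarrow> |Y k| \<le>o |L|"
    and Y_cofinality_omega: "k \<in> K \<Longrightarrow> t \<in> Y k \<Longrightarrow> range t \<subseteq> cofinality_omega"
    and Y_separated: "k \<in> K \<Longrightarrow> k' \<in> K \<Longrightarrow> t \<in> Y k \<Longrightarrow> t' \<in> Y k' \<Longrightarrow> tail_equivalent t t' \<Longrightarrow> k = k'"
    and Y_guesses: "k \<in> K \<Longrightarrow> self_map h \<Longrightarrow> \<exists>t\<in>Y k. range t \<subseteq> closure_points h"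
begin

definition coded_colours :: "'v graph \<Rightarrow> 'k set" where
  "coded_colours G = {k \<in> K. \<forall>b. numbering L G b \<longrightarrow>
    (\<exists>v r. nbh_ray G v r \<and> (\<exists>t\<in>Y k. ray_codes G b r t))}"

lemma coded_colours_mono:
  assumes "weakly_embeds G H"
  shows "coded_colours G \<subseteq> coded_colours H"
proof
  obtain f where f: "graph_embedding f G H"
    using weakly_embeds_imp_graph_embedding[OF assms] by blast
  fix k assume k: "k \<in> coded_colours G"
  have "\<exists>v r. nbh_ray H v r \<and> (\<exists>t\<in>Y k. ray_codes H b r t)" if b: "numbering L H b" for b
  proof -
    obtain v r t where "nbh_ray G v r" "t \<in> Y k" "ray_codes G (b \<circ> f) r t"
      using k numbering_comp_embedding[OF f b] unfolding coded_colours_def by blast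
    then show ?thesis using nbh_ray_graph_embedding[OF f] ray_codes_embedding[OF f] by blast
  qed
  then show "k \<in> coded_colours H" using k unfolding coded_colours_def by blast
qed

lemma card_of_coded_colours:
  assumes G: "G \<in> class_G" "|verts G| \<le>o |L|"
  shows "|coded_colours G| \<le>o |L|"
proof -
  obtain b where "inj_on b (verts G)" "b ` verts G \<subseteq> L" using G(2) by (rule card_of_ordLeqE)
  then have b: "numbering L G b" by (simp add: numbering_def)
  let ?X = "\<lambda>r. {k \<in> K. \<exists>t\<in>Y k. ray_codes G b r t}"
  have "|?X r| \<le>o |L|" for r
  proof (rule card_of_subsingleton_bound[OF Cinfinite_L])
    fix k k' assume "k \<in> ?X r" "k' \<in> ?X r"
    then show "k = k'" using ray_codes_unique[OF G(1)] Y_separated tail_equivalent_refl by blast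
  qed
  then have "|\<Union>r\<in>nbh_rays G. ?X r| \<le>o |L|"
    using G Cinfinite_L by (intro UNION_Cinfinite_bound card_of_nbh_rays) auto
  moreover have "coded_colours G \<subseteq> (\<Union>r\<in>nbh_rays G. ?X r)"
    using b unfolding coded_colours_def nbh_rays_def by blast
  ultimately show ?thesis using card_of_mono1 ordLeq_transitive by blast
qed

definition guessing_codes :: "'k set \<Rightarrow> ('a \<Rightarrow> 'a) \<Rightarrow> (nat \<Rightarrow> 'a) set" where
  "guessing_codes A h = {t \<in> \<Union> (Y ` A). range t \<subseteq> closure_points h}"

lemma guessing_codes_cofinality_omega:
  "A \<subseteq> K \<Longrightarrow> t \<in> guessing_codes A h \<Longrightarrow> range t \<subseteq> cofinality_omega"
  using Y_cofinality_omega unfolding guessing_codes_def by blast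

lemma card_of_guessing_codes:
  assumes "A \<subseteq> K" "|A| \<le>o |L|"
  shows "|guessing_codes A h| \<le>o |L|"
proof -
  have "|guessing_codes A h| \<le>o |\<Union> (Y ` A)|"
    unfolding guessing_codes_def by (intro card_of_mono1) blast
  also have "|\<Union> (Y ` A)| \<le>o |L|"
    using assms card_of_Y Cinfinite_L by (intro UNION_Cinfinite_bound) auto
  finally show ?thesis .
qed

lemma guessing_codes_subset_coded_colours:
  assumes A: "A \<subseteq> K" and h: "self_map h"
  shows "A \<subseteq> coded_colours (tree_fans L ladder (guessing_codes A h))"
proof
  let ?T = "guessing_codes A h"
  fix k assume k: "k \<in> A"
  have "\<exists>v r. nbh_ray (tree_fans L ladder ?T) v r \<and>
      (\<exists>t\<in>Y k. ray_codes (tree_fans L ladder ?T) b r t)"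
    if b: "numbering L (tree_fans L ladder ?T) b" for b
  proof -
    obtain g where g: "self_map g"
      "\<And>y. y \<in> closure_points g \<Longrightarrow> y \<in> cofinality_omega \<Longrightarrow> order_lim (b \<circ> branch (ladder y)) y"
      using tree_fans_branch_limit[OF b] by blast
    let ?m = "\<lambda>x. max (g x) (h x)"
    have "self_map ?m" using g(1) h by (auto simp: self_map_def max_def)
    then obtain t where t: "t \<in> Y k" "range t \<subseteq> closure_points ?m" using Y_guesses A k by blast
    have "closure_points ?m \<subseteq> closure_points g" "closure_points ?m \<subseteq> closure_points h"
      by (rule closure_points_antimono; simp)+
    then have tg: "range t \<subseteq> closure_points g" and tT: "t \<in> ?T"
      using t k unfolding guessing_codes_def by blast+
    have cof: "range t \<subseteq> cofinality_omega" using A tT by (rule guessing_codes_cofinality_omega)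
    then have "ray_codes (tree_fans L ladder ?T) b (Base t) t"
      using tg g(2) by (intro tree_fans_ray_codes_Apex[OF tT]) blast+
    then show ?thesis using tree_fans_nbh_ray_Apex[OF tT] t(1) by blast
  qed
  then show "k \<in> coded_colours (tree_fans L ladder ?T)"
    using A k unfolding coded_colours_def by blast
qed

lemma coded_colours_tree_fans_subset:
  assumes A: "A \<subseteq> K" and b: "numbering L (tree_fans L ladder (guessing_codes A h)) b"
    and lim: "\<And>y. y \<in> closure_points h \<Longrightarrow> y \<in> cofinality_omega \<Longrightarrow> order_lim (b \<circ> branch (ladder y)) y"
  shows "coded_colours (tree_fans L ladder (guessing_codes A h)) \<subseteq> A"
proof
  let ?T = "guessing_codes A h"
  fix k assume "k \<in> coded_colours (tree_fans L ladder ?T)"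
  then obtain v r t where k: "k \<in> K" "t \<in> Y k" and r: "nbh_ray (tree_fans L ladder ?T) v r"
    and code: "ray_codes (tree_fans L ladder ?T) b r t"
    using b unfolding coded_colours_def by blast
  have "order_lim (b \<circ> branch (ladder (t' n))) (t' n)" if "t' \<in> ?T" for t' n
    using guessing_codes_cofinality_omega[OF A that] that
    unfolding guessing_codes_def by (intro lim) blast+
  then obtain t' where t': "t' \<in> ?T" "tail_equivalent t t'"
    using tree_fans_ray_codesD[OF _ r code] by blast
  then obtain k' where "k' \<in> A" "t' \<in> Y k'" unfolding guessing_codes_def by blast
  then show "k \<in> A" using Y_separated[OF k(1) _ k(2) _ t'(2)] A by blast
qed

lemma coded_colours_realized:
  assumes A: "A \<subseteq> K" "|A| \<le>o |L|"
  shows "\<exists>G :: 'a tree_vertex graph. G \<in> class_G \<and> |verts G| =o |L| \<and> coded_colours G = A"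
proof -
  have "|lists L| \<le>o |L|" using Cinfinite_L by (rule card_of_lists_le)
  from disjoint_injections_ex[OF Cinfinite_L this]
  obtain \<nu> \<kappa> where \<nu>: "inj_on \<nu> (lists L)" "\<nu> ` lists L \<subseteq> L"
    and \<kappa>: "inj_on \<kappa> L" "\<kappa> ` L \<subseteq> L" "\<nu> ` lists L \<inter> \<kappa> ` L = {}"
    by (elim exE conjE)
  obtain h where h: "self_map h"
    and lim: "\<And>y. y \<in> closure_points h \<Longrightarrow> y \<in> cofinality_omega \<Longrightarrow>
      order_lim (\<lambda>j. \<nu> (map (ladder y) [0..<j])) y"
    using ladder_initial_list_limit[OF \<nu>] by blast
  let ?T = "guessing_codes A h" and ?G = "tree_fans L ladder (guessing_codes A h)"
  have T: "|?T| \<le>o |L|" using A by (rule card_of_guessing_codes)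
  obtain b where b: "numbering L ?G b" and b_Node: "\<And>s. s \<in> lists L \<Longrightarrow> b (Node s) = \<nu> s"
    using tree_fans_numbering_extension[OF \<nu> \<kappa> T] by blast
  have "order_lim (b \<circ> branch (ladder y)) y" if y: "y \<in> closure_points h" "y \<in> cofinality_omega"
    for y
  proof -
    have "map (ladder y) [0..<j] \<in> lists L" for j using ladder_in_L[OF y(2)] by auto
    then show ?thesis using lim[OF y] by (simp add: comp_def branch_def b_Node)
  qed
  then have "coded_colours ?G = A"
    using guessing_codes_subset_coded_colours[OF A(1) h] coded_colours_tree_fans_subset[OF A(1) b]
    by blast
  moreover have "?G \<in> class_G"
    using guessing_codes_cofinality_omega[OF A(1)] ladder_in_L by (intro tree_fans_in_class_G) blast
  moreover have "|verts ?G| =o |L|" using Cinfinite_L T by (rule card_of_tree_fans)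
  ultimately show ?thesis by blast
qed

theorem hom_onto_subsets_of_colour_system:
  fixes l :: "'l rel"
  assumes l: "Card_order l" "|L| =o l"
  shows "hom_onto_subsets l K"
proof (rule hom_onto_subsets_of_invariant[where \<Psi> = coded_colours, OF l(1)])
  show "coded_colours G \<subseteq> K \<and> |coded_colours G| \<le>o l" if G: "G \<in> graphs_of_size l" for G
  proof -
    have "|verts G| =o |L|"
      using G ordIso_transitive[OF _ ordIso_symmetric[OF l(2)]]
      unfolding graphs_of_size_def by blast
    then have "|coded_colours G| \<le>o |L|"
      using G by (intro card_of_coded_colours) (auto simp: graphs_of_size_def ordIso_imp_ordLeq)
    then have "|coded_colours G| \<le>o l" using l(2) by (rule ordLeq_ordIso_trans)
    then show ?thesis unfolding coded_colours_def by blast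
  qed
  show "\<exists>G :: 'a tree_vertex graph. G \<in> class_G \<and> |verts G| =o l \<and>
      (\<forall>H :: 'l graph. graph_iso G H \<longrightarrow> coded_colours H = A)" if A: "A \<subseteq> K" "|A| \<le>o l" for A
  proof -
    have "|A| \<le>o |L|" using A(2) ordIso_symmetric[OF l(2)] by (rule ordLeq_ordIso_trans)
    then obtain G :: "'a tree_vertex graph"
      where G: "G \<in> class_G" "|verts G| =o |L|" "coded_colours G = A"
      using coded_colours_realized[OF A(1)] by blast
    have "coded_colours H = A" if H: "graph_iso G H" for H :: "'l graph"
    proof -
      have "is_graph G" using G(1) by (simp add: class_G_def)
      from graph_iso_imp_weakly_embeds[OF this H, THEN coded_colours_mono] show ?thesis
        using G(3) by blast
    qed
    then show ?thesis using G ordIso_transitive[OF G(2) l(2)] by blast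
  qed
qed (rule coded_colours_mono)

end

section \<open>Colours from stationary sets\<close>

context regular_uncountable
begin

lemma colour_system_of_splitting:
  "colour_system L {a \<in> L. stationary {y \<in> cofinality_omega. ladder y n = a}}
    (\<lambda>a. (\<lambda>y _. y) ` {y \<in> cofinality_omega. ladder y n = a})" (is "colour_system L ?K ?Y")
proof unfold_locales
  fix a
  have "{y \<in> cofinality_omega. ladder y n = a} \<subseteq> L" using cofinality_omega_subset by blast
  then show "|?Y a| \<le>o |L|" by (intro card_of_image_bound card_of_mono1)
next
  fix a h assume "a \<in> ?K" "self_map h"
  then obtain y where "y \<in> cofinality_omega" "ladder y n = a" "y \<in> closure_points h"
    using stationaryD by blast
  then show "\<exists>t\<in>?Y a. range t \<subseteq> closure_points h" by (intro bexI[of _ "\<lambda>_. y"]) auto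
qed (auto simp: tail_equivalent_def)

lemma hom_onto_subsets_if_card_le:
  fixes l :: "'l rel" and M :: "'m set"
  assumes l: "Card_order l" "|L| =o l" and M: "|M| \<le>o |L|"
  shows "hom_onto_subsets l M"
proof -
  obtain n where "|L| \<le>o |{a \<in> L. stationary {y \<in> cofinality_omega. ladder y n = a}}|"
    using stationary_splitting by blast
  then have "|M| \<le>o |{a \<in> L. stationary {y \<in> cofinality_omega. ladder y n = a}}|"
    using M ordLeq_transitive by blast
  with colour_system.hom_onto_subsets_of_colour_system[OF colour_system_of_splitting l]
  show ?thesis by (rule hom_onto_subsets_antimono)
qed

end

section \<open>Colours from guessing families\<close>

locale prefix_coding =
  fixes N :: "'m set" and code :: "'m list \<Rightarrow> 'm"
  assumes code_inj: "inj_on code (lists N)" and code_in: "code ` lists N \<subseteq> N"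
begin

definition prefix_seq :: "(nat \<Rightarrow> 'm) \<Rightarrow> nat \<Rightarrow> 'm" where
  "prefix_seq \<eta> n = code (map \<eta> [0..<n])"

lemma prefix_list: "\<eta> \<in> Func UNIV N \<Longrightarrow> map \<eta> [0..<n] \<in> lists N"
  by (auto simp: Func_def)

lemma prefix_seq_in: "\<eta> \<in> Func UNIV N \<Longrightarrow> prefix_seq \<eta> n \<in> N"
  using code_in prefix_list unfolding prefix_seq_def by blast

lemma eq_if_prefix_seq_tails_eq:
  assumes c: "inj_on c N" and \<eta>: "\<eta> \<in> Func UNIV N" and \<theta>: "\<theta> \<in> Func UNIV N"
    and eq: "\<And>k. c (prefix_seq \<eta> (i + k)) = c (prefix_seq \<theta> (i + k))"
  shows "\<eta> = \<theta>"
proof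
  fix n
  have "prefix_seq \<eta> (i + Suc n) = prefix_seq \<theta> (i + Suc n)"
    using eq inj_onD[OF c] prefix_seq_in[OF \<eta>] prefix_seq_in[OF \<theta>] by blast
  then have "map \<eta> [0..<i + Suc n] = map \<theta> [0..<i + Suc n]"
    using inj_onD[OF code_inj] prefix_list[OF \<eta>] prefix_list[OF \<theta>] unfolding prefix_seq_def by blast
  then show "\<eta> n = \<theta> n" by (simp add: map_eq_conv del: upt_Suc)
qed

text \<open>Different sequences may be read off the same ray through different members of \<open>C\<close>. As this
  identifies fewer than \<open>|Func UNIV N|\<close> many with each one, an unconfusable set of full size remains.\<close>

definition confusable :: "('m \<Rightarrow> 'a) set \<Rightarrow> (nat \<Rightarrow> 'm) \<Rightarrow> (nat \<Rightarrow> 'm) \<Rightarrow> bool" where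
  "confusable C \<eta> \<theta> \<longleftrightarrow> (\<exists>c\<in>C. \<exists>d\<in>C. tail_equivalent (c \<circ> prefix_seq \<eta>) (d \<circ> prefix_seq \<theta>))"

lemma card_of_confusable:
  assumes r: "Cinfinite r" and C: "|C| \<le>o r" "\<And>c. c \<in> C \<Longrightarrow> inj_on c N"
  shows "|{\<eta> \<in> Func UNIV N. confusable C \<eta> \<theta>}| \<le>o r"
proof -
  let ?I = "C \<times> C \<times> (UNIV :: nat set) \<times> (UNIV :: nat set)"
  let ?X = "\<lambda>(c, d, i, j).
    {\<eta> \<in> Func UNIV N. \<forall>k. c (prefix_seq \<eta> (i + k)) = d (prefix_seq \<theta> (j + k))}"
  have "|?X p| \<le>o r" if "p \<in> ?I" for p
  proof (rule card_of_subsingleton_bound[OF r])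
    obtain c d i j where p: "p = (c, d, i, j)" "c \<in> C" using \<open>p \<in> ?I\<close> by (cases p) auto
    fix \<eta> \<zeta> assume "\<eta> \<in> ?X p" "\<zeta> \<in> ?X p"
    then show "\<eta> = \<zeta>"
      unfolding p(1) by (intro eq_if_prefix_seq_tails_eq[OF C(2)[OF p(2)], of \<eta> \<zeta> i]) auto
  qed
  moreover have "|?I| \<le>o r" using C(1) r by (intro Times_Cinfinite_bound card_of_nat_bound)
  ultimately have "|\<Union>p\<in>?I. ?X p| \<le>o r" using r by (intro UNION_Cinfinite_bound) auto
  moreover have "{\<eta> \<in> Func UNIV N. confusable C \<eta> \<theta>} \<subseteq> (\<Union>p\<in>?I. ?X p)"
  proof
    fix \<eta> assume \<eta>: "\<eta> \<in> {\<eta> \<in> Func UNIV N. confusable C \<eta> \<theta>}"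
    then obtain c d i j where "(c, d, i, j) \<in> ?I"
      "\<forall>k. c (prefix_seq \<eta> (i + k)) = d (prefix_seq \<theta> (j + k))"
      unfolding confusable_def tail_equivalent_def by auto
    then show "\<eta> \<in> (\<Union>p\<in>?I. ?X p)" using \<eta> by (intro UN_I[of "(c, d, i, j)"]) auto
  qed
  ultimately show ?thesis using card_of_mono1 ordLeq_transitive by blast
qed

lemma unconfusable_subset_ex:
  assumes r: "Cinfinite r" "r <o |Func (UNIV :: nat set) N|"
    and C: "|C| \<le>o r" "\<And>c. c \<in> C \<Longrightarrow> inj_on c N"
  shows "\<exists>K\<subseteq>Func UNIV N. pairwise (\<lambda>\<eta> \<theta>. \<not> confusable C \<eta> \<theta>) K \<and> |Func (UNIV :: nat set) N| \<le>o |K|"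
proof (rule independent_subset_full_card[OF r])
  show "symp (confusable C)"
    unfolding symp_def confusable_def using tail_equivalent_sym by blast
  show "|{\<eta> \<in> Func UNIV N. confusable C \<eta> \<theta>}| \<le>o r" for \<theta>
    using r(1) C by (rule card_of_confusable)
qed

end

context regular_uncountable
begin

lemma hom_onto_subsets_Func_if_card_less:
  fixes l :: "'l rel" and N :: "'m set"
  assumes l: "Card_order l" "|L| =o l" and N: "infinite N" "cardSuc |N| <o |L|"
    and large: "|L| <o |Func (UNIV :: nat set) N|"
  shows "hom_onto_subsets l (Func (UNIV :: nat set) N)"
proof -
  obtain C where C: "guessing_family N C" using guessing_family_ex[OF N] by blast
  have "|lists N| \<le>o |N|"
    using N(1) by (simp add: card_of_lists_le Cinfinite_card_of_iff)
  then obtain code where "inj_on code (lists N)" "code ` lists N \<subseteq> N" by (rule card_of_ordLeqE)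
  then interpret prefix_coding N code by unfold_locales
  have card_C: "|C| \<le>o |L|" and inj_C: "\<And>c. c \<in> C \<Longrightarrow> inj_on c N"
    and C_cofinality: "\<And>c. c \<in> C \<Longrightarrow> c ` N \<subseteq> cofinality_omega"
    and C_guesses: "\<And>h. self_map h \<Longrightarrow> \<exists>c\<in>C. c ` N \<subseteq> closure_points h"
    using C unfolding guessing_family_def by blast+
  obtain K where K: "K \<subseteq> Func UNIV N" "pairwise (\<lambda>\<eta> \<theta>. \<not> confusable C \<eta> \<theta>) K"
    and full: "|Func (UNIV :: nat set) N| \<le>o |K|"
    using unconfusable_subset_ex[OF Cinfinite_L large card_C inj_C] by blast
  let ?Y = "\<lambda>\<eta>. (\<lambda>c. c \<circ> prefix_seq \<eta>) ` C"
  have range_subset_image: "range (c \<circ> prefix_seq \<eta>) \<subseteq> c ` N" if "\<eta> \<in> K" for c :: "'m \<Rightarrow> 'a" and \<eta>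
    using prefix_seq_in K(1) that by auto
  have "colour_system L K ?Y"
  proof unfold_locales
    show "|?Y \<eta>| \<le>o |L|" for \<eta> using card_C by (rule card_of_image_bound)
    show "range t \<subseteq> cofinality_omega" if "\<eta> \<in> K" "t \<in> ?Y \<eta>" for \<eta> t
      using range_subset_image[OF that(1)] C_cofinality that(2) by blast
    show "\<eta> = \<theta>" if "\<eta> \<in> K" "\<theta> \<in> K" "s \<in> ?Y \<eta>" "t \<in> ?Y \<theta>" "tail_equivalent s t" for \<eta> \<theta> s t
      using K(2) that unfolding pairwise_def confusable_def by blast
    show "\<exists>t\<in>?Y \<eta>. range t \<subseteq> closure_points h" if "\<eta> \<in> K" "self_map h" for \<eta> h
      using C_guesses[OF that(2)] range_subset_image[OF that(1)] by blast
  qed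
  then have "hom_onto_subsets l K" using l by (rule colour_system.hom_onto_subsets_of_colour_system)
  then show ?thesis using full by (rule hom_onto_subsets_antimono)
qed

lemma hom_onto_subsets_Func:
  fixes l :: "'l rel" and N :: "'m set"
  assumes l: "Card_order l" "|L| =o l" and N: "infinite N" "cardSuc |N| <o |L|"
  shows "hom_onto_subsets l (Func (UNIV :: nat set) N)"
proof (cases "|Func (UNIV :: nat set) N| \<le>o |L|")
  case True
  with l show ?thesis by (rule hom_onto_subsets_if_card_le)
next
  case False
  then have "|L| <o |Func (UNIV :: nat set) N|"
    by (simp add: not_ordLeq_iff_ordLess card_of_Well_order)
  with assms show ?thesis by (rule hom_onto_subsets_Func_if_card_less)
qed

end

section \<open>Regular cardinals as initial segments of a well-ordered type\<close>

typedef 'a position = "UNIV :: 'a set" ..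

instantiation position :: (type) linorder
begin

definition less_eq_position :: "'a position \<Rightarrow> 'a position \<Rightarrow> bool" where
  "x \<le> y \<longleftrightarrow> (Rep_position x, Rep_position y) \<in> |UNIV :: 'a set|"

definition less_position :: "'a position \<Rightarrow> 'a position \<Rightarrow> bool" where
  "x < y \<longleftrightarrow> x \<le> y \<and> \<not> y \<le> (x :: 'a position)"

instance
proof
  let ?W = "|UNIV :: 'a set|"
  have W: "refl ?W" "trans ?W" "antisym ?W" "total ?W"
    using card_of_well_order_on[of "UNIV :: 'a set"]
    unfolding well_order_on_def linear_order_on_def partial_order_on_def preorder_on_def by auto
  fix x y z :: "'a position"
  show "x < y \<longleftrightarrow> x \<le> y \<and> \<not> y \<le> x" by (rule less_position_def)
  show "x \<le> x" using W(1) by (simp add: less_eq_position_def refl_on_def)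
  show "x \<le> y \<Longrightarrow> y \<le> z \<Longrightarrow> x \<le> z" using W(2) unfolding less_eq_position_def by (rule transD)
  show "x \<le> y \<Longrightarrow> y \<le> x \<Longrightarrow> x = y"
    using W(3) unfolding less_eq_position_def by (simp add: antisymD flip: Rep_position_inject)
  show "x \<le> y \<or> y \<le> x"
    using W(1,4) unfolding less_eq_position_def refl_on_def total_on_def by (metis UNIV_I)
qed

end

instance position :: (type) wellorder
proof (rule wf_wellorderI)
  let ?W = "|UNIV :: 'a set|"
  have "wf (inv_image (?W - Id) Rep_position)"
    using card_of_well_order_on[of "UNIV :: 'a set"]
    unfolding well_order_on_def by (intro wf_inv_image) blast
  moreover have "{(x, y :: 'a position). x < y} \<subseteq> inv_image (?W - Id) Rep_position"
    by (auto simp: less_le less_eq_position_def Rep_position_inject)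
  ultimately show "wf {(x, y :: 'a position). x < y}" by (rule wf_subset)
qed standard

lemma initial_segment_position_ex:
  fixes l :: "'l rel"
  assumes l: "Card_order l"
  shows "\<exists>p :: 'l \<Rightarrow> 'l position. inj_on p (Field l) \<and> (\<forall>a\<in>Field l. {..<p a} = p ` underS l a)"
proof -
  let ?W = "|UNIV :: 'l set|"
  have wo: "Well_order l" using l card_order_on_well_order_on by blast
  have "|Field l| \<le>o ?W" by (rule card_of_mono1) simp
  then have "l \<le>o ?W" using l card_of_Field_ordIso ordIso_symmetric ordIso_ordLeq_trans by blast
  then obtain f where f: "embed l ?W f" unfolding ordLeq_def by blast
  define p where "p a = Abs_position (f a)" for a
  have Rep_p: "Rep_position (p a) = f a" for a by (simp add: p_def Abs_position_inverse)
  have "inj_on p (Field l)"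
    using embed_inj_on[OF wo f] by (simp add: inj_on_def p_def Abs_position_inject)
  moreover have "{..<p a} = p ` underS l a" if a: "a \<in> Field l" for a
  proof -
    have "f ` underS l a = underS ?W (f a)"
      using embed_underS[OF wo f a] by (simp add: bij_betw_def)
    moreover have "x \<in> {..<p a} \<longleftrightarrow> Rep_position x \<in> underS ?W (f a)" for x
      by (auto simp: less_le less_eq_position_def underS_def Rep_p simp flip: Rep_position_inject)
    moreover have "x \<in> p ` X \<longleftrightarrow> Rep_position x \<in> f ` X" for x X
      unfolding image_iff Rep_p[symmetric] Rep_position_inject ..
    ultimately show ?thesis by blast
  qed
  ultimately show ?thesis by blast
qed

lemma regularCard_small_subset_bounded:
  assumes l: "Cinfinite l" "regularCard l" and X: "X \<subseteq> Field l" "|X| <o l"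
  shows "\<exists>c\<in>Field l. X \<subseteq> underS l c"
proof -
  have "Well_order l" using l(1) card_order_on_well_order_on by blast
  then have order: "total_on (Field l) l" "trans l" "antisym l"
    unfolding well_order_on_def linear_order_on_def partial_order_on_def preorder_on_def by auto
  have "\<not> |X| =o l" using X(2) by (rule not_ordLess_ordIso)
  then have "\<not> cofinal X l" using l(2) X(1) unfolding regularCard_def by blast
  then obtain a where a: "a \<in> Field l" "\<And>b. b \<in> X \<Longrightarrow> a = b \<or> (a, b) \<notin> l"
    unfolding cofinal_def by blast
  obtain c where c: "c \<in> Field l" "a \<noteq> c" "(a, c) \<in> l" using Cinfinite_limit[OF a(1) l(1)] by blast
  have "b \<in> underS l c" if "b \<in> X" for b
  proof -
    have "a = b \<or> (b, a) \<in> l"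
      using a(1) a(2)[OF that] X(1) that order(1) unfolding total_on_def by blast
    then show ?thesis using c order(2,3) unfolding underS_def by (auto dest: transD antisymD)
  qed
  then show ?thesis using c(1) by blast
qed

lemma regular_uncountable_ex:
  fixes l :: "'l rel"
  assumes l: "Cinfinite l" "regularCard l" "natLeq <o l"
  shows "\<exists>L :: 'l position set. regular_uncountable L \<and> |L| =o l"
proof -
  obtain p :: "'l \<Rightarrow> 'l position" where p: "inj_on p (Field l)"
    and below: "\<And>a. a \<in> Field l \<Longrightarrow> {..<p a} = p ` underS l a"
    using initial_segment_position_ex[OF conjunct2[OF l(1)]] by (elim exE conjE) simp
  define L where "L = p ` Field l"
  have "bij_betw p (Field l) L" using p unfolding L_def by (rule inj_on_imp_bij_betw)
  then have "|L| =o |Field l|" using card_of_ordIsoI ordIso_symmetric by blast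
  then have Ll: "|L| =o l" using l(1) card_of_Field_ordIso ordIso_transitive by blast
  have "regular_uncountable L"
  proof
    fix x y assume "y \<in> L" "x < y"
    then show "x \<in> L" using below unfolding L_def underS_def Field_def by blast
  next
    fix x assume "x \<in> L"
    then obtain a where a: "a \<in> Field l" "x = p a" unfolding L_def by blast
    have "|{..<x}| \<le>o |underS l a|" unfolding a(2) below[OF a(1)] by (rule card_of_image)
    also have "|underS l a| <o l" using l(1) a(1) by (simp add: card_of_underS)
    also have "l =o |L|" using Ll by (rule ordIso_symmetric)
    finally show "|{..<x}| <o |L|" .
  next
    fix X assume X: "X \<subseteq> L" "|X| <o |L|"
    let ?A = "{a \<in> Field l. p a \<in> X}"
    have "inj_on p ?A" using p by (rule inj_on_subset) blast
    then have "|?A| \<le>o |X|" by (rule card_of_ordLeqI) blast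
    also have "|X| <o |L|" by (rule X(2))
    also have "|L| =o l" by (rule Ll)
    finally obtain c where c: "c \<in> Field l" "?A \<subseteq> underS l c"
      using regularCard_small_subset_bounded[OF l(1,2), of ?A] by blast
    then have "X \<subseteq> {..<p c}" using X(1) below[OF c(1)] unfolding L_def by blast
    then show "\<exists>b\<in>L. \<forall>x\<in>X. x < b" using c(1) unfolding L_def by blast
  next
    show "natLeq <o |L|" using l(3) ordIso_symmetric[OF Ll] by (rule ordLess_ordIso_trans)
  qed
  then show ?thesis using Ll by blast
qed

section \<open>Powers with exponent \<open>\<aleph>\<^sub>0\<close>\<close>

lemma subsets_upto_cexp_natLeq:
  "subsets_upto (m ^c natLeq) l = {A. A \<subseteq> Func UNIV (Field m) \<and> |A| \<le>o l}"
  unfolding subsets_upto_def cexp_def by (simp add: Field_card_of Field_natLeq)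

lemma card_of_Func_finite:
  assumes "finite N"
  shows "|Func (UNIV :: nat set) N| \<le>o |UNIV :: (nat \<Rightarrow> bool) set|"
proof -
  have "|N| ^c natLeq \<le>o ctwo ^c natLeq"
    using assms card_of_Card_order[of N]
    by (intro Cfinite_cexp_Cinfinite natLeq_Cinfinite) (simp add: cfinite_def Field_card_of)
  then have "|Func (UNIV :: nat set) N| \<le>o |Func (UNIV :: nat set) (UNIV :: bool set)|"
    unfolding cexp_def ctwo_def by (simp add: Field_card_of Field_natLeq)
  also have "|Func (UNIV :: nat set) (UNIV :: bool set)| \<le>o |UNIV :: (nat \<Rightarrow> bool) set|"
    by (rule card_of_mono1) simp
  finally show ?thesis .
qed

theorem theorem2p4:
  fixes l :: "'l rel" and m :: "'m rel"
  assumes "Cinfinite l" and "regularCard l"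
    and "Card_order m" and "cardSuc m <o l"
  shows "\<exists>\<Phi> :: 'l graph set \<Rightarrow> (nat \<Rightarrow> 'm) set.
    monotone_on (iso_types l) le_w (\<subseteq>) \<Phi> \<and>
    \<Phi> ` iso_types l = subsets_upto (m ^c natLeq) l"
  unfolding subsets_upto_cexp_natLeq hom_onto_subsets_def[symmetric]
proof (cases "finite (Field m)")
  case True
  then show "hom_onto_subsets l (Func (UNIV :: nat set) (Field m))"
    by (rule hom_onto_subsets_if_le_continuum[OF assms(1) card_of_Func_finite])
next
  case False
  have m: "|Field m| =o m" using assms(3) by (rule card_of_Field_ordIso)
  then have suc: "cardSuc |Field m| <o l"
    using assms(3,4) cardSuc_invar_ordIso card_of_Card_order ordIso_ordLess_trans by blast
  have "natLeq \<le>o |Field m|" using False infinite_iff_natLeq_ordLeq by blast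
  also have "|Field m| <o cardSuc |Field m|" by (simp add: cardSuc_greater card_of_Card_order)
  also note suc
  finally obtain L :: "'l position set" where L: "regular_uncountable L" "|L| =o l"
    using regular_uncountable_ex[OF assms(1,2)] by blast
  have "cardSuc |Field m| <o |L|" using suc ordIso_symmetric[OF L(2)] by (rule ordLess_ordIso_trans)
  then show "hom_onto_subsets l (Func (UNIV :: nat set) (Field m))"
    using regular_uncountable.hom_onto_subsets_Func[OF L(1) _ L(2) False] assms(1) by blast
qed

end
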